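(* Let $a\ge0$ and let $f(t)$ be a probability density with support $[a,\infty)$ which is continuous on $(a,\infty)$. Then $f$ is the density of a generalized gamma convolution if and only if $f$ satisfies $$(a-t)f(t)+\int_a^tf(s)\int_{t-s}^\infty m(x)\,dx\,ds=0,\qquad t\ge a,$$ for some completely monotone function $m:(0,\infty)\to[0,\infty)$ such that $\int_0^\infty\log^+(x)\,m(x)\,dx<\infty$.
   Context: A probability measure $\mu$ on $\mathbb{R}_+=[0,\infty)$ is a generalized gamma convolution if its Laplace transform is $\int_{[0,\infty)}e^{-ux}\mu(dx)=e^{-\psi_\mu(u)}$ with $\psi_\mu(u)=bu+\int_{(0,\infty)}(1-e^{-ut})\frac{k(t)}{t}\,dt$, $u\ge0$, for some $b\ge0$ and some completely monotone function $k:(0,\infty)\to[0,\infty)$ (with $\int_{(0,\infty)}\min(1,t)\frac{k(t)}{t}dt<\infty$). Equivalently, the generalized gamma convolutions form the smallest class of laws on $\mathbb{R}_+$ containing all gamma distributions and closed under convolution and weak limits. A function $h:(0,\infty)\to[0,\infty)$ is completely monotone if it is $C^\infty$ and $(-1)^nh^{(n)}\ge0$ for all $n\ge0$. *)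

theory Defs
  imports "HOL-Probability.Probability"
begin

text \<open>
  Functions on $(0,\infty)$ are represented by total functions on the reals whose values on
  $(-\infty,0]$ are irrelevant. Since $(0,\infty)$ is open, the iterated two-sided derivatives
  at a point \<open>x > 0\<close> only depend on \<open>h\<close> near \<open>x\<close>. The case \<open>n = 0\<close> of the sign condition says
  that \<open>h\<close> is nonnegative on $(0,\infty)$.
\<close>

definition completely_monotone :: "(real \<Rightarrow> real) \<Rightarrow> bool" where
  "completely_monotone h \<longleftrightarrow>
     (\<forall>n. \<forall>x>0. (deriv ^^ n) h field_differentiable (at x)) \<and>
     (\<forall>n. \<forall>x>0. (-1) ^ n * (deriv ^^ n) h x \<ge> 0)"

text \<open>
  A probability measure on $\mathbb{R}_+$ is a Borel probability measure on the reals giving full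
  mass to $[0,\infty)$. Since $0 \le 1 - e^{-ut} \le \max(1,u)\min(1,t)$ for $u, t \ge 0$, the
  integrability condition on \<open>k\<close> makes the integral in the exponent convergent.
\<close>

definition generalized_gamma_convolution :: "real measure \<Rightarrow> bool" where
  "generalized_gamma_convolution \<mu> \<longleftrightarrow>
     prob_space \<mu> \<and> sets \<mu> = sets borel \<and> measure \<mu> {0..} = 1 \<and>
     (\<exists>b k. b \<ge> 0 \<and> completely_monotone k \<and>
        set_integrable lborel {0<..} (\<lambda>t. min 1 t * (k t / t)) \<and>
        (\<forall>u\<ge>0. (LINT x:{0..}|\<mu>. exp (- u * x)) =
           exp (- (b * u + (LINT t:{0<..}|lborel. (1 - exp (- u * t)) * (k t / t))))))"

text \<open>
  $(a-t)f(t)+\int_a^t f(s)\int_{t-s}^\infty m(x)\,dx\,ds=0$ for all $t \ge a$. Convergence of the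
  outer integral is required explicitly because a divergent Bochner integral has value 0. The
  inner integral converges for \<open>s < t\<close> as soon as \<open>m\<close> is completely monotone and
  $\log^+ \cdot m$ is integrable; it may diverge at \<open>s = t\<close>, which is a null set.
\<close>

definition satisfies_integral_equation ::
    "real \<Rightarrow> (real \<Rightarrow> real) \<Rightarrow> (real \<Rightarrow> real) \<Rightarrow> bool" where
  "satisfies_integral_equation a m f \<longleftrightarrow>
     (\<forall>t\<ge>a. set_integrable lborel {a..t} (\<lambda>s. f s * (LINT x:{t - s<..}|lborel. m x)) \<and>
        (a - t) * f t + (LINT s:{a..t}|lborel. f s * (LINT x:{t - s<..}|lborel. m x)) = 0)"

end

theory Submission imports Defs
begin

text \<open>
  Let $L$ be the Laplace transform of $f$. Differentiating $L = e^{-\psi}$ with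
  $\psi(u) = bu + \int_0^\infty (1 - e^{-ut}) k(t)/t\,dt$ gives $-L' = \psi' L$, where
  $\psi'(u) = b + \int_0^\infty e^{-ut} k(t)\,dt$. Hence the functions $t f(t)$ and $b f + f * k$ have the
  same Laplace transform; both are continuous on $(a,\infty)$, so they agree there. That $b = a$
  follows from $L(u) \le e^{-au}$ and $\psi(u)/u \to b$ on the one hand, and from
  $(t - b) f(t) = (f * k)(t) \ge 0$ on the other. This is the integral equation with $m = -k'$, and
  $k$ is the tail integral of $m$ because integrability of $k(t)/t$ at infinity forces $k(\infty) = 0$.
  Conversely, the equation yields $-L' = (a + \int_0^\infty e^{-ut} k(t)\,dt) L$, so $L e^{\psi}$ is
  constant. By Tonelli, $\int_1^\infty k(t)/t\,dt = \int_1^\infty \log(x)\, m(x)\,dx$, whereas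
  integrability of $k$ near $0$ comes from convergence of the convolution integral at a point
  where $f$ is positive.
\<close>

subsection \<open>Laplace exponents\<close>

text \<open>Two singularities shape the proof: k may blow up at 0 and f may blow up at a. Pointwise
  agreement of t f(t) and b f + f * k needs continuity of f * k on (a, \<infinity>); for this k is
  cut at a small d, so that no integrand meets both singularities at once. Moreover f a is
  arbitrary, because the support only fixes f to the left of a. At t = a the equation holds since
  the factor a - t and the convolution both vanish. One family of facts, on integrals of 1 -
  exp(-ux) against a weight g with min(1,x) g(x) integrable, serves two weights: the Levy density
  k(t)/t, which yields the exponent, and f itself, since 1 - L is such an integral. Derivatives are
  taken only at u > 0, as x g(x) may fail to be integrable at infinity; continuity at 0 is shown
  separately and supplies the initial value L(0) = 1. Functions on (0, \<infinity>) are cut off by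
  \<open>indicator {0<..}\<close>, which discards their irrelevant values and turns f * k into an
  integral over the whole line.\<close>

lemma tendsto_integral_dominated_within:
  fixes F :: "real \<Rightarrow> 'b \<Rightarrow> real"
  assumes meas: "\<And>u. u \<in> S \<Longrightarrow> F u \<in> borel_measurable M" "F0 \<in> borel_measurable M"
    and w: "integrable M w"
    and bound: "\<And>u. u \<in> S \<Longrightarrow> u \<noteq> u0 \<Longrightarrow> AE x in M. \<bar>F u x\<bar> \<le> w x"
    and lim: "AE x in M. ((\<lambda>u. F u x) \<longlongrightarrow> F0 x) (at u0 within S)"
  shows "((\<lambda>u. \<integral>x. F u x \<partial>M) \<longlongrightarrow> (\<integral>x. F0 x \<partial>M)) (at u0 within S)"
proof (subst tendsto_at_iff_sequentially, intro allI impI)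
  fix X :: "nat \<Rightarrow> real" assume X: "\<forall>i. X i \<in> S - {u0}" "X \<longlonglongrightarrow> u0"
  have "(\<lambda>n. \<integral>x. F (X n) x \<partial>M) \<longlonglongrightarrow> (\<integral>x. F0 x \<partial>M)"
  proof (rule integral_dominated_convergence[OF _ _ w])
    show "AE x in M. (\<lambda>n. F (X n) x) \<longlonglongrightarrow> F0 x"
      using lim
    proof eventually_elim
      case (elim x)
      then show ?case using X unfolding tendsto_at_iff_sequentially comp_def by blast
    qed
    \<comment> \<open>Test sequences avoid \<open>u0\<close>, so the bound can be restricted to
      other points; this admits difference quotients, which divide by 0 at
      \<open>u0\<close>.\<close>
    show "AE x in M. norm (F (X n) x) \<le> w x" for n
      using bound[of "X n"] X(1) by auto
  qed (use X meas in auto)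
  then show "((\<lambda>u. \<integral>x. F u x \<partial>M) \<circ> X) \<longlonglongrightarrow> (\<integral>x. F0 x \<partial>M)"
    by (simp add: comp_def)
qed

lemma one_minus_exp_le:
  fixes u x :: real
  assumes "u \<ge> 0" "x \<ge> 0"
  shows "1 - exp (- u * x) \<ge> 0" "1 - exp (- u * x) \<le> max 1 u * min 1 x"
proof -
  show "1 - exp (- u * x) \<ge> 0" using assms by simp
  have a: "1 - exp (- u * x) \<le> 1" by simp
  have b: "1 - exp (- u * x) \<le> u * x" using exp_ge_add_one_self[of "- u * x"] by simp
  show "1 - exp (- u * x) \<le> max 1 u * min 1 x"
  proof (cases "x \<le> 1")
    case True
    have "u * x \<le> max 1 u * x" using assms by (intro mult_right_mono) auto
    with b True show ?thesis by simp
  next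
    case False
    have "1 \<le> max 1 u" by simp
    with a have "1 - exp (- u * x) \<le> max 1 u" by (rule order_trans)
    with False show ?thesis by simp
  qed
qed

lemma mult_exp_minus_le:
  fixes u x :: real
  assumes "u > 0" "x \<ge> 0"
  shows "x * exp (- u * x) \<le> max 1 (1 / u) * min 1 x"
proof -
  have a: "x * exp (- u * x) \<le> x"
    using assms mult_left_mono[of "exp (- u * x)" 1 x] by simp
  have "u * x \<le> exp (u * x)" using exp_ge_add_one_self[of "u * x"] by linarith
  then have b: "x * exp (- u * x) \<le> 1 / u"
    using assms by (simp add: exp_minus field_simps)
  show ?thesis
  proof (cases "x \<le> 1")
    case True
    have "1 * x \<le> max 1 (1 / u) * x" using assms by (intro mult_right_mono) auto
    with a True show ?thesis by simp
  next
    case False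
    with b show ?thesis by simp
  qed
qed

section \<open>Integrals of 1 - exp(-ux) and x exp(-ux) against a weight g\<close>

context
  fixes g :: "real \<Rightarrow> real"
  assumes g_meas [measurable]: "g \<in> borel_measurable borel"
    and g_nonneg: "\<And>x. g x \<ge> 0"
    and g_neg: "\<And>x. x < 0 \<Longrightarrow> g x = 0"
    and g_int: "integrable lborel (\<lambda>x. min 1 x * g x)"
begin

lemma integrable_one_minus_exp_mult:
  assumes "u \<ge> 0"
  shows "integrable lborel (\<lambda>x. (1 - exp (- u * x)) * g x)"
proof (rule Bochner_Integration.integrable_bound)
  show "integrable lborel (\<lambda>x. max 1 u * (min 1 x * g x))" using g_int by (rule integrable_mult_right)
  show "AE x in lborel. norm ((1 - exp (- u * x)) * g x) \<le> norm (max 1 u * (min 1 x * g x))"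
  proof (rule AE_I2)
    fix x
    show "norm ((1 - exp (- u * x)) * g x) \<le> norm (max 1 u * (min 1 x * g x))"
    proof (cases "x < 0")
      case True
      then show ?thesis by (simp add: g_neg)
    next
      case False
      then show ?thesis
        using mult_right_mono[OF one_minus_exp_le(2)[of u x] g_nonneg[of x]] one_minus_exp_le(1)[of u x] assms g_nonneg[of x]
        by (simp add: abs_mult mult.assoc)
    qed
  qed
qed auto

lemma integrable_mult_exp_mult:
  assumes "u > 0"
  shows "integrable lborel (\<lambda>x. x * exp (- u * x) * g x)"
proof (rule Bochner_Integration.integrable_bound)
  show "integrable lborel (\<lambda>x. max 1 (1 / u) * (min 1 x * g x))" using g_int by (rule integrable_mult_right)
  show "AE x in lborel. norm (x * exp (- u * x) * g x) \<le> norm (max 1 (1 / u) * (min 1 x * g x))"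
  proof (rule AE_I2)
    fix x
    show "norm (x * exp (- u * x) * g x) \<le> norm (max 1 (1 / u) * (min 1 x * g x))"
    proof (cases "x < 0")
      case True
      then show ?thesis by (simp add: g_neg)
    next
      case False
      then show ?thesis
        using mult_right_mono[OF mult_exp_minus_le[of u x] g_nonneg[of x]] assms g_nonneg[of x]
        by (simp add: abs_mult mult.assoc)
    qed
  qed
qed auto

text \<open>By the mean value theorem the difference quotients at u are at most x exp(-zx) g(x) with
  z between u and v. Keeping v above u/2 gives the single majorant x exp(-ux/2) g(x), integrable
  because u/2 is still positive.\<close>

lemma has_real_derivative_integral_one_minus_exp:
  assumes u: "u > 0"
  shows "((\<lambda>u. \<integral>x. (1 - exp (- u * x)) * g x \<partial>lborel) has_real_derivative
    (\<integral>x. x * exp (- u * x) * g x \<partial>lborel)) (at u)"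
proof -
  let ?Q = "\<lambda>v x. ((1 - exp (- v * x)) * g x - (1 - exp (- u * x)) * g x) / (v - u)"
  have "((\<lambda>v. \<integral>x. ?Q v x \<partial>lborel) \<longlongrightarrow> (\<integral>x. x * exp (- u * x) * g x \<partial>lborel)) (at u within {u/2<..})"
  proof (rule tendsto_integral_dominated_within[OF _ _ integrable_mult_exp_mult[of "u/2"]])
    fix v assume v: "v \<in> {u/2<..}" "v \<noteq> u"
    show "AE x in lborel. \<bar>?Q v x\<bar> \<le> x * exp (- (u/2) * x) * g x"
    proof (rule AE_I2)
      fix x :: real
      show "\<bar>?Q v x\<bar> \<le> x * exp (- (u/2) * x) * g x"
      proof (cases "x < 0")
        case True
        then show ?thesis by (simp add: g_neg)
      next
        case False
        \<comment> \<open>Ordering the endpoints by \<open>min\<close> and \<open>max\<close> covers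
          v < u and v > u at once.\<close>
        have "\<exists>z. min u v < z \<and> z < max u v \<and>
          exp (- max u v * x) - exp (- min u v * x) = (max u v - min u v) * (- x * exp (- z * x))"
          by (rule MVT2) (use v in \<open>auto intro!: derivative_eq_intros\<close>)
        then obtain z where z: "min u v < z"
          "exp (- max u v * x) - exp (- min u v * x) = (max u v - min u v) * (- x * exp (- z * x))" by blast
        have "\<bar>exp (- v * x) - exp (- u * x)\<bar> = \<bar>exp (- max u v * x) - exp (- min u v * x)\<bar>"
          by (auto simp: max_def min_def)
        also have "\<dots> = \<bar>v - u\<bar> * (x * exp (- z * x))"
          using False unfolding z(2) by (auto simp: abs_mult)
        also have "\<dots> \<le> \<bar>v - u\<bar> * (x * exp (- (u/2) * x))"
        proof -
          have "u/2 * x \<le> z * x" using z(1) u v False by (intro mult_right_mono) auto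
          then show ?thesis using False by (intro mult_left_mono) auto
        qed
        finally have *: "\<bar>exp (- v * x) - exp (- u * x)\<bar> \<le> \<bar>v - u\<bar> * (x * exp (- (u/2) * x))" .
        have "?Q v x = (exp (- u * x) - exp (- v * x)) * g x / (v - u)"
          by (simp add: algebra_simps)
        then have "\<bar>?Q v x\<bar> = \<bar>exp (- v * x) - exp (- u * x)\<bar> * g x / \<bar>v - u\<bar>"
          using g_nonneg[of x] by (simp only: abs_divide abs_mult abs_of_nonneg abs_minus_commute[of "exp (- u * x)"])
        also have "\<dots> \<le> (\<bar>v - u\<bar> * (x * exp (- (u/2) * x))) * g x / \<bar>v - u\<bar>"
          by (intro divide_right_mono mult_right_mono * g_nonneg) auto
        also have "\<dots> = x * exp (- (u/2) * x) * g x" using v by simp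
        finally show ?thesis .
      qed
    qed
  next
    show "AE x in lborel. ((\<lambda>v. ?Q v x) \<longlongrightarrow> x * exp (- u * x) * g x) (at u within {u/2<..})"
    proof (rule AE_I2)
      fix x
      have "((\<lambda>v. (1 - exp (- v * x)) * g x) has_real_derivative x * exp (- u * x) * g x) (at u within {u/2<..})"
        by (auto intro!: derivative_eq_intros)
      then show "((\<lambda>v. ?Q v x) \<longlongrightarrow> x * exp (- u * x) * g x) (at u within {u/2<..})"
        by (simp add: has_field_derivative_iff)
    qed
  qed (use u in auto)
  moreover have "at u within {u/2<..} = at u" using u by (intro at_within_open) auto
  moreover have "eventually (\<lambda>v. (\<integral>x. ?Q v x \<partial>lborel) = 
      ((\<integral>x. (1 - exp (- v * x)) * g x \<partial>lborel) - (\<integral>x. (1 - exp (- u * x)) * g x \<partial>lborel)) / (v - u)) (at u)"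
  proof -
    have "eventually (\<lambda>v. v \<in> {0<..}) (at u)"
      using u by (intro eventually_at_in_open') auto
    then show ?thesis
    proof eventually_elim
      case (elim v)
      then have "(\<integral>x. ?Q v x \<partial>lborel) = (\<integral>x. (1 - exp (- v * x)) * g x - (1 - exp (- u * x)) * g x \<partial>lborel) / (v - u)"
        by (intro integral_divide_zero)
      then show ?case using elim u integrable_one_minus_exp_mult[of u] integrable_one_minus_exp_mult[of v] by simp
    qed
  qed
  ultimately show ?thesis unfolding has_field_derivative_iff by (simp only: tendsto_cong)
qed

lemma continuous_on_integral_one_minus_exp:
  "continuous_on {0..} (\<lambda>u. \<integral>x. (1 - exp (- u * x)) * g x \<partial>lborel)"
proof -
  let ?G = "\<lambda>u. \<integral>x. (1 - exp (- u * x)) * g x \<partial>lborel"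
  have "(?G \<longlongrightarrow> ?G u) (at u within {0..})" if u: "u \<ge> 0" for u
  proof (cases "u = 0")
    case False
    with u have "u > 0" by simp
    then have "isCont ?G u" by (rule DERIV_isCont[OF has_real_derivative_integral_one_minus_exp])
    then have "continuous (at u within {0..}) ?G" by (rule continuous_at_imp_continuous_at_within)
    then show ?thesis by (simp only: continuous_within)
  next
    case True
    \<comment> \<open>On [0,1] the factor max(1,v) of the general bound is 1, so min(1,x) g(x)
      dominates uniformly in v.\<close>
    have "(?G \<longlongrightarrow> ?G u) (at u within {0..1})"
    proof (rule tendsto_integral_dominated_within[OF _ _ integrable_mult_right[OF g_int, of 1]])
      fix v :: real assume v: "v \<in> {0..1}"
      show "AE x in lborel. \<bar>(1 - exp (- v * x)) * g x\<bar> \<le> 1 * (min 1 x * g x)"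
      proof (rule AE_I2)
        fix x
        show "\<bar>(1 - exp (- v * x)) * g x\<bar> \<le> 1 * (min 1 x * g x)"
        proof (cases "x < 0")
          case True
          then show ?thesis by (simp add: g_neg)
        next
          case False
          then show ?thesis
            using mult_right_mono[OF one_minus_exp_le(2)[of v x] g_nonneg[of x]] one_minus_exp_le(1)[of v x] v g_nonneg[of x]
            by (simp add: abs_mult mult.assoc max_absorb1)
        qed
      qed
    next
      show "AE x in lborel. ((\<lambda>v. (1 - exp (- v * x)) * g x) \<longlongrightarrow> (1 - exp (- u * x)) * g x) (at u within {0..1})"
        by (intro AE_I2 tendsto_intros)
    qed auto
    moreover have "at u within {0..1} = at u within {0..}"
      unfolding True by (rule at_within_nhd[of _ "{..<1}"]) auto
    ultimately show ?thesis by simp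
  qed
  then show ?thesis by (auto simp: continuous_on_def)
qed

text \<open>For u \<ge> 1 the factor max(1,u) of the general bound cancels against the division by
  u, leaving the majorant min(1,x) g(x). In the exponent this says that the linear growth at
  infinity comes from the drift alone.\<close>

lemma tendsto_integral_one_minus_exp_over:
  "((\<lambda>u. (\<integral>x. (1 - exp (- u * x)) * g x \<partial>lborel) / u) \<longlongrightarrow> 0) at_top"
proof -
  have "((\<lambda>u. \<integral>x. (1 - exp (- u * x)) * g x / u \<partial>lborel) \<longlongrightarrow> (\<integral>x. 0 \<partial>(lborel :: real measure))) at_top"
  proof (rule integral_dominated_convergence_at_top[where w = "\<lambda>x. min 1 x * g x"])
    show "\<forall>\<^sub>F u in at_top. AE x in lborel. norm ((1 - exp (- u * x)) * g x / u) \<le> min 1 x * g x"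
      using eventually_ge_at_top[of 1]
    proof eventually_elim
      case (elim u)
      show ?case
      proof (rule AE_I2)
        fix x
        show "norm ((1 - exp (- u * x)) * g x / u) \<le> min 1 x * g x"
        proof (cases "x < 0")
          case True
          then show ?thesis by (simp add: g_neg)
        next
          case False
          then show ?thesis
            using mult_right_mono[OF one_minus_exp_le(2)[of u x] g_nonneg[of x]] one_minus_exp_le(1)[of u x] elim g_nonneg[of x]
            by (simp add: abs_mult max_absorb2 pos_divide_le_eq mult.assoc mult.commute[of u])
        qed
      qed
    qed
  next
    show "AE x in lborel. ((\<lambda>u. (1 - exp (- u * x)) * g x / u) \<longlongrightarrow> 0) at_top"
    proof (rule AE_I2)
      fix x
      show "((\<lambda>u. (1 - exp (- u * x)) * g x / u) \<longlongrightarrow> 0) at_top"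
      proof (cases "x < 0")
        case True
        then show ?thesis by (simp add: g_neg)
      next
        case False
        have "((\<lambda>u. g x / u) \<longlongrightarrow> 0) at_top"
          by (rule tendsto_divide_0[OF tendsto_const]) (rule filterlim_at_top_imp_at_infinity, rule filterlim_ident)
        then show ?thesis
        proof (rule Lim_null_comparison[rotated])
          show "\<forall>\<^sub>F u in at_top. norm ((1 - exp (- u * x)) * g x / u) \<le> g x / u"
            using eventually_gt_at_top[of 0]
          proof eventually_elim
            case (elim u)
            then have "(1 - exp (- u * x)) * g x \<le> 1 * g x" by (intro mult_right_mono g_nonneg) auto
            then show ?case using elim one_minus_exp_le(1)[of u x] False g_nonneg[of x]
              by (simp add: abs_mult divide_right_mono)
          qed
        qed
      qed
    qed
  qed (use g_int in auto)
  then show ?thesis by simp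
qed

end

subsection \<open>Completely monotone functions and their tails\<close>

lemma higher_deriv_cong_pos:
  fixes f g :: "real \<Rightarrow> real"
  assumes "\<And>x. x > 0 \<Longrightarrow> f x = g x" "x > 0"
  shows "(deriv ^^ n) f x = (deriv ^^ n) g x"
  using assms(2)
proof (induction n arbitrary: x)
  case (Suc n)
  have "eventually (\<lambda>y. y \<in> {0<..}) (nhds x)" using Suc.prems by (intro eventually_nhds_in_open) auto
  then have "eventually (\<lambda>y. (deriv ^^ n) f y = (deriv ^^ n) g y) (nhds x)"
    by eventually_elim (use Suc.IH in auto)
  then show ?case by (simp add: deriv_cong_ev)
qed (use assms in auto)

lemma higher_deriv_uminus_pos:
  fixes h :: "real \<Rightarrow> real"
  assumes "\<And>n x. x > 0 \<Longrightarrow> (deriv ^^ n) h field_differentiable (at x)" "x > 0"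
  shows "(deriv ^^ n) (\<lambda>x. - h x) x = - (deriv ^^ n) h x"
  using assms(2)
proof (induction n arbitrary: x)
  case (Suc n)
  have "(deriv ^^ Suc n) (\<lambda>x. - h x) x = deriv (\<lambda>x. - (deriv ^^ n) h x) x"
    using higher_deriv_cong_pos[of "(deriv ^^ n) (\<lambda>x. - h x)" "\<lambda>x. - (deriv ^^ n) h x" x 1] Suc
    by simp
  also have "\<dots> = - deriv ((deriv ^^ n) h) x"
    using assms(1)[OF Suc.prems, of n]
    by (intro DERIV_imp_deriv derivative_intros) (simp add: DERIV_deriv_iff_field_differentiable)
  finally show ?case by simp
qed simp

lemma completely_monotone_has_derivative:
  assumes "completely_monotone h" "x > 0"
  shows "(h has_real_derivative deriv h x) (at x)"
  using assms unfolding completely_monotone_def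
  by (metis DERIV_deriv_iff_field_differentiable funpow_0)

lemma completely_monotone_nonneg:
  assumes "completely_monotone h" "x > 0"
  shows "h x \<ge> 0"
  using assms unfolding completely_monotone_def
  by (metis funpow_0 mult_1 power_0)

lemma completely_monotone_deriv_nonpos:
  assumes "completely_monotone h" "x > 0"
  shows "deriv h x \<le> 0"
proof -
  have "(-1) ^ 1 * (deriv ^^ 1) h x \<ge> 0" using assms unfolding completely_monotone_def by blast
  then show ?thesis by simp
qed

lemma completely_monotone_antimono:
  assumes "completely_monotone h" "0 < x" "x \<le> y"
  shows "h y \<le> h x"
proof (rule DERIV_nonpos_imp_nonincreasing[OF assms(3)])
  fix z assume "x \<le> z"
  with assms(2) have "z > 0" by simp
  then show "\<exists>d. (h has_real_derivative d) (at z) \<and> d \<le> 0"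
    using completely_monotone_has_derivative[OF assms(1)] completely_monotone_deriv_nonpos[OF assms(1)] by blast
qed

lemma completely_monotone_continuous_on:
  assumes "completely_monotone h"
  shows "continuous_on {0<..} h"
  using completely_monotone_has_derivative[OF assms]
  by (meson DERIV_isCont continuous_at_imp_continuous_on greaterThan_iff)

lemma completely_monotone_measurable:
  assumes "completely_monotone h"
  shows "(\<lambda>x. indicator {0<..} x * h x) \<in> borel_measurable borel"
  using borel_measurable_continuous_on_indicator[OF _ completely_monotone_continuous_on[OF assms]]
  by simp

text \<open>The sign condition of order n for -h' is the one of order n + 1 for h.\<close>

lemma completely_monotone_uminus_deriv:
  assumes "completely_monotone h"
  shows "completely_monotone (\<lambda>x. - deriv h x)"
proof -
  have d: "(deriv ^^ n) h field_differentiable (at x)" if "x > 0" for n x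
    using assms that unfolding completely_monotone_def by blast
  have d': "(deriv ^^ n) (deriv h) field_differentiable (at x)" if "x > 0" for n x
    using d[OF that, of "Suc n"] by (simp add: funpow_swap1)
  have eq: "(deriv ^^ n) (\<lambda>x. - deriv h x) x = - (deriv ^^ n) (deriv h) x" if "x > 0" for n x
    using d' that by (rule higher_deriv_uminus_pos)
  show ?thesis unfolding completely_monotone_def
  proof (intro conjI allI impI)
    fix n and x :: real assume x: "x > 0"
    have "((\<lambda>x. - (deriv ^^ n) (deriv h) x) has_real_derivative - deriv ((deriv ^^ n) (deriv h)) x) (at x)"
      using d'[OF x, of n] by (intro derivative_intros) (simp add: DERIV_deriv_iff_field_differentiable)
    then have "((deriv ^^ n) (\<lambda>x. - deriv h x) has_real_derivative - deriv ((deriv ^^ n) (deriv h)) x) (at x)"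
      by (rule has_field_derivative_transform_within_open[of _ _ _ "{0<..}"]) (use x eq in auto)
    then show "(deriv ^^ n) (\<lambda>x. - deriv h x) field_differentiable (at x)"
      by (auto simp: field_differentiable_def)
    have "(-1) ^ Suc n * (deriv ^^ Suc n) h x \<ge> 0"
      using assms x unfolding completely_monotone_def by blast
    then show "0 \<le> (-1) ^ n * (deriv ^^ n) (\<lambda>x. - deriv h x) x"
      using eq[OF x] by (simp add: funpow_swap1)
  qed
qed

text \<open>Derivatives of k of order n + 1 are those of -m of order n, so the sign conditions shift
  by one. Order 0 is not seen by m and has to come from nonnegativity of k.\<close>

lemma completely_monotone_antiderivative:
  assumes m: "completely_monotone m"
    and k: "\<And>x. x > 0 \<Longrightarrow> (k has_real_derivative - m x) (at x)" "\<And>x. x > 0 \<Longrightarrow> k x \<ge> 0"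
  shows "completely_monotone k"
proof -
  have d: "(deriv ^^ n) m field_differentiable (at x)" if "x > 0" for n x
    using m that unfolding completely_monotone_def by blast
  have eq: "(deriv ^^ Suc n) k x = - (deriv ^^ n) m x" if "x > 0" for n x
  proof -
    have "(deriv ^^ Suc n) k x = (deriv ^^ n) (deriv k) x" by (simp add: funpow_swap1)
    also have "\<dots> = (deriv ^^ n) (\<lambda>x. - m x) x"
      using DERIV_imp_deriv[OF k(1)] that by (intro higher_deriv_cong_pos) auto
    also have "\<dots> = - (deriv ^^ n) m x" using d that by (rule higher_deriv_uminus_pos)
    finally show ?thesis .
  qed
  show ?thesis unfolding completely_monotone_def
  proof (intro conjI allI impI)
    fix n and x :: real assume x: "x > 0"
    show "(deriv ^^ n) k field_differentiable (at x)"
    proof (cases n)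
      case 0
      then show ?thesis using k(1)[OF x] by (auto simp: field_differentiable_def)
    next
      case (Suc j)
      have "((\<lambda>x. - (deriv ^^ j) m x) has_real_derivative - deriv ((deriv ^^ j) m) x) (at x)"
        using d[OF x, of j] by (intro derivative_intros) (simp add: DERIV_deriv_iff_field_differentiable)
      then have "((deriv ^^ Suc j) k has_real_derivative - deriv ((deriv ^^ j) m) x) (at x)"
        by (rule has_field_derivative_transform_within_open[of _ _ _ "{0<..}"]) (use x eq in auto)
      then show ?thesis unfolding Suc by (auto simp: field_differentiable_def)
    qed
    show "0 \<le> (-1) ^ n * (deriv ^^ n) k x"
    proof (cases n)
      case (Suc j)
      have "(-1) ^ j * (deriv ^^ j) m x \<ge> 0" using m x unfolding completely_monotone_def by blast
      then show ?thesis using eq[OF x, of j] Suc by simp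
    qed (use k(2)[OF x] in simp)
  qed
qed

section \<open>The logarithmic weight, tail integrals and the Levy integrability of k\<close>

lemma nn_integral_inverse_Ioo:
  assumes "x > 0"
  shows "(\<integral>\<^sup>+t. ennreal (indicator {1<..<x} t / t) \<partial>lborel) = ennreal (max 0 (ln x))"
proof (cases "x \<ge> 1")
  case True
  have "(\<integral>\<^sup>+t. ennreal (indicator {1<..<x} t / t) \<partial>lborel) =
      (\<integral>\<^sup>+t. ennreal (indicator {1..x} t * (1 / t)) \<partial>lborel)"
    by (rule nn_integral_cong_AE, use AE_lborel_singleton[of 1] AE_lborel_singleton[of x] in eventually_elim)
       (auto simp: indicator_def)
  also have "\<dots> = (\<integral>\<^sup>+t. ennreal (1 / t) * indicator {1..x} t \<partial>lborel)"
    by (rule nn_integral_cong) (auto simp: indicator_def)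
  also have "\<dots> = ennreal (ln x - ln 1)"
    by (rule nn_integral_FTC_Icc) (use True in \<open>auto intro!: derivative_eq_intros\<close>)
  finally show ?thesis using True by (simp add: max_absorb2)
next
  case False
  then have "indicator {1<..<x} t = (0::real)" for t by auto
  moreover have "max 0 (ln x) = 0" using False assms by (simp add: max_def)
  ultimately show ?thesis by simp
qed

text \<open>Both sides integrate h(x)/t over the wedge 1 < t < x, in the two orders. As an identity
  in [0, \<infinity>] it can be read in both directions: from log-integrability of m to k(t)/t at
  infinity, and back.\<close>

lemma nn_integral_log_weight:
  fixes h :: "real \<Rightarrow> real"
  assumes [measurable]: "h \<in> borel_measurable borel" and h: "\<And>x. h x \<ge> 0" "\<And>x. x \<le> 0 \<Longrightarrow> h x = 0"
  shows "(\<integral>\<^sup>+t. ennreal (indicator {1<..} t / t) * (\<integral>\<^sup>+x. ennreal (indicator {t<..} x * h x) \<partial>lborel) \<partial>lborel)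
    = (\<integral>\<^sup>+x. ennreal (max 0 (ln x) * h x) \<partial>lborel)"
proof -
  have [measurable]: "{p::real\<times>real. fst p < snd p} \<in> sets borel"
    by (intro borel_open open_Collect_less) (auto intro!: continuous_intros)
  have "(\<integral>\<^sup>+t. ennreal (indicator {1<..} t / t) * (\<integral>\<^sup>+x. ennreal (indicator {t<..} x * h x) \<partial>lborel) \<partial>lborel)
     = (\<integral>\<^sup>+t. \<integral>\<^sup>+x. ennreal (h x) * ennreal (indicator {1<..} t * indicator {p. fst p < snd p} (t, x) / t) \<partial>lborel \<partial>lborel)"
    by (auto simp: nn_integral_cmult[symmetric] ennreal_mult'[symmetric] h indicator_def intro!: nn_integral_cong)
  also have "\<dots> = (\<integral>\<^sup>+x. \<integral>\<^sup>+t. ennreal (h x) * ennreal (indicator {1<..} t * indicator {p. fst p < snd p} (t, x) / t) \<partial>lborel \<partial>lborel)"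
    by (rule lborel_pair.Fubini') measurable
  also have "\<dots> = (\<integral>\<^sup>+x. ennreal (h x) * (\<integral>\<^sup>+t. ennreal (indicator {1<..<x} t / t) \<partial>lborel) \<partial>lborel)"
    by (auto simp: nn_integral_cmult[symmetric] indicator_def intro!: nn_integral_cong)
  also have "\<dots> = (\<integral>\<^sup>+x. ennreal (max 0 (ln x) * h x) \<partial>lborel)"
  proof (rule nn_integral_cong)
    fix x
    show "ennreal (h x) * (\<integral>\<^sup>+t. ennreal (indicator {1<..<x} t / t) \<partial>lborel) = ennreal (max 0 (ln x) * h x)"
    \<comment> \<open>For x \<le> 0 both sides are 0 because h is; the value of \<open>ln\<close>
      there is only a convention.\<close>
    proof (cases "x > 0")
      case True
      then show ?thesis using ennreal_mult[OF h(1)[of x], of "max 0 (ln x)"]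
        by (simp only: nn_integral_inverse_Ioo mult.commute max.cobounded1)
    qed (simp add: h)
  qed
  finally show ?thesis .
qed

text \<open>On [r, e] continuity of m suffices; beyond e the weight log x is at least 1.\<close>

lemma completely_monotone_set_integrable_tail:
  assumes m: "completely_monotone m"
    and log: "set_integrable lborel {0<..} (\<lambda>x. max 0 (ln x) * m x)" and r: "r > 0"
  shows "set_integrable lborel {r<..} m"
  unfolding set_integrable_def
proof (rule Bochner_Integration.integrable_bound)
  have "set_integrable lborel {r..exp 1} m"
    using completely_monotone_continuous_on[OF m] r
    by (intro borel_integrable_atLeastAtMost') (auto intro: continuous_on_subset)
  then show "integrable lborel (\<lambda>x. indicator {r..exp 1} x *\<^sub>R m x + indicator {0<..} x *\<^sub>R (max 0 (ln x) * m x))"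
    using log unfolding set_integrable_def by (rule Bochner_Integration.integrable_add)
  have "(\<lambda>x. indicator {r<..} x *\<^sub>R (indicator {0<..} x * m x)) \<in> borel_measurable borel"
    by (intro borel_measurable_scaleR completely_monotone_measurable[OF m]) auto
  also have "(\<lambda>x. indicator {r<..} x *\<^sub>R (indicator {0<..} x * m x)) = (\<lambda>x. indicator {r<..} x *\<^sub>R m x)"
    using r by (auto simp: indicator_def)
  finally show "(\<lambda>x. indicator {r<..} x *\<^sub>R m x) \<in> borel_measurable lborel" by simp
  show "AE x in lborel. norm (indicator {r<..} x *\<^sub>R m x)
      \<le> norm (indicator {r..exp 1} x *\<^sub>R m x + indicator {0<..} x *\<^sub>R (max 0 (ln x) * m x))"
  proof (rule AE_I2)
    fix x
    show "norm (indicator {r<..} x *\<^sub>R m x)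
      \<le> norm (indicator {r..exp 1} x *\<^sub>R m x + indicator {0<..} x *\<^sub>R (max 0 (ln x) * m x))"
    proof (cases "x > r")
      case False
      then show ?thesis by simp
    next
      case True
      then have x: "x > 0" "m x \<ge> 0" using completely_monotone_nonneg[OF m] r by auto
      show ?thesis
      proof (cases "x \<le> exp 1")
        case True
        have "m x \<le> m x + max 0 (ln x) * m x" using x by simp
        then show ?thesis using True \<open>x > r\<close> x by simp
      next
        case False
        then have "ln x \<ge> 1" using x by (simp add: ln_ge_iff)
        then have "1 * m x \<le> max 0 (ln x) * m x" using x by (intro mult_right_mono) auto
        then show ?thesis using False \<open>x > r\<close> x by simp
      qed
    qed
  qed
qed

text \<open>Since m may have infinite integral at 0, the fundamental theorem of calculus is applied
  from the base point t/2: near t the tail integral is a constant minus the integral from t/2 to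
  s.\<close>

lemma tail_integral_has_derivative:
  assumes m: "completely_monotone m"
    and log: "set_integrable lborel {0<..} (\<lambda>x. max 0 (ln x) * m x)" and t: "t > 0"
  shows "((\<lambda>t. LINT x:{t<..}|lborel. m x) has_real_derivative - m t) (at t)"
proof -
  note int = completely_monotone_set_integrable_tail[OF m log]
  have cont: "continuous_on {t/2..2*t} m"
    using completely_monotone_continuous_on[OF m] t by (auto intro: continuous_on_subset)
  have "((\<lambda>s. integral {t/2..s} m) has_real_derivative m t) (at t within {t/2..2*t})"
    by (rule integral_has_real_derivative[OF cont]) (use t in auto)
  moreover have "at t within {t/2..2*t} = at t" by (rule at_within_interior) (use t in auto)
  ultimately have d: "((\<lambda>s. (LINT x:{t/2<..}|lborel. m x) - integral {t/2..s} m) has_real_derivative - m t) (at t)"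
    by (auto intro!: derivative_eq_intros)
  show ?thesis
  proof (rule has_field_derivative_transform_within_open[OF d, of "{t/2<..}"])
    fix s assume s: "s \<in> {t/2<..}"
    then have un: "{t/2<..} = {t/2<..s} \<union> {s<..}" by auto
    have i: "set_integrable lborel {t/2<..s} m"
      by (rule set_integrable_subset[OF int[of "t/2"]]) (use t in auto)
    have "(LINT x:{t/2<..}|lborel. m x) = (LINT x:{t/2<..s}|lborel. m x) + (LINT x:{s<..}|lborel. m x)"
      unfolding un by (rule set_integral_Un[OF _ i int]) (use s t in auto)
    moreover have "(LINT x:{t/2<..s}|lborel. m x) = integral {t/2<..s} m"
      using i by (rule set_borel_integral_eq_integral)
    moreover have "integral {t/2<..s} m = integral {t/2..s} m"
      by (rule integral_spike_set) (auto intro: negligible_subset[of "{t/2}"])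
    ultimately show "(LINT x:{t/2<..}|lborel. m x) - integral {t/2..s} m = (LINT x:{s<..}|lborel. m x)"
      by simp
  qed (use t in auto)
qed

lemma completely_monotone_tail_integral:
  assumes m: "completely_monotone m"
    and log: "set_integrable lborel {0<..} (\<lambda>x. max 0 (ln x) * m x)"
  shows "completely_monotone (\<lambda>t. LINT x:{t<..}|lborel. m x)"
proof (rule completely_monotone_antiderivative[OF m tail_integral_has_derivative[OF m log]])
  fix t :: real assume "t > 0"
  then show "0 \<le> (LINT x:{t<..}|lborel. m x)"
    unfolding set_lebesgue_integral_def
    by (intro Bochner_Integration.integral_nonneg) (auto simp: indicator_def completely_monotone_nonneg[OF m])
qed

text \<open>This is the half of the Levy condition on k that m alone controls. The half near 0 also
  depends on f and is supplied by \<open>kernel_set_integrable\<close>.\<close>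

lemma integrable_tail_integral_over:
  assumes m: "completely_monotone m"
    and log: "set_integrable lborel {0<..} (\<lambda>x. max 0 (ln x) * m x)"
  shows "integrable lborel (\<lambda>t. indicator {1<..} t * ((LINT x:{t<..}|lborel. m x) / t))"
proof -
  define k where "k t = (LINT x:{t<..}|lborel. m x)" for t
  define h where "h x = indicator {0<..} x * m x" for x
  have k: "completely_monotone k"
    unfolding k_def using completely_monotone_tail_integral[OF m log] .
  have h_meas [measurable]: "h \<in> borel_measurable borel"
    unfolding h_def using completely_monotone_measurable[OF m] by simp
  have h: "h x \<ge> 0" for x unfolding h_def by (auto simp: indicator_def completely_monotone_nonneg[OF m])
  have kk: "(\<lambda>t. indicator {0<..} t * k t) \<in> borel_measurable borel"
    using completely_monotone_measurable[OF k] .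
  have eq: "(\<lambda>t. indicator {1<..} t * (k t / t)) = (\<lambda>t. indicator {1<..} t * (indicator {0<..} t * k t) / t)"
    by (auto simp: indicator_def)
  have "(\<integral>\<^sup>+t. ennreal (indicator {1<..} t * (k t / t)) \<partial>lborel) =
      (\<integral>\<^sup>+t. ennreal (indicator {1<..} t / t) * (\<integral>\<^sup>+x. ennreal (indicator {t<..} x * h x) \<partial>lborel) \<partial>lborel)"
  proof (rule nn_integral_cong)
    fix t
    show "ennreal (indicator {1<..} t * (k t / t)) = 
      ennreal (indicator {1<..} t / t) * (\<integral>\<^sup>+x. ennreal (indicator {t<..} x * h x) \<partial>lborel)"
    proof (cases "t > 1")
      case True
      have "(\<lambda>x. indicator {t<..} x * h x) = (\<lambda>x. indicator {t<..} x *\<^sub>R m x)"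
        using True by (auto simp: h_def indicator_def)
      moreover have "integrable lborel (\<lambda>x. indicator {t<..} x *\<^sub>R m x)"
        using completely_monotone_set_integrable_tail[OF m log, of t] True by (simp add: set_integrable_def)
      ultimately have "(\<integral>\<^sup>+x. ennreal (indicator {t<..} x * h x) \<partial>lborel) = ennreal (k t)"
        unfolding k_def set_lebesgue_integral_def
        by (subst nn_integral_eq_integral) (use h in auto)
      then show ?thesis using True completely_monotone_nonneg[OF k, of t]
        by (simp add: ennreal_mult'[symmetric])
    qed simp
  qed
  also have "\<dots> = (\<integral>\<^sup>+x. ennreal (max 0 (ln x) * h x) \<partial>lborel)"
    by (rule nn_integral_log_weight[OF h_meas h]) (simp add: h_def)
  also have "\<dots> = (\<integral>\<^sup>+x. ennreal (indicator {0<..} x *\<^sub>R (max 0 (ln x) * m x)) \<partial>lborel)"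
    by (intro nn_integral_cong) (auto simp: h_def indicator_def)
  also have "\<dots> < \<infinity>"
    using log unfolding set_integrable_def
    by (subst nn_integral_eq_integral) (auto simp: indicator_def completely_monotone_nonneg[OF m])
  finally have fin: "(\<integral>\<^sup>+t. ennreal (indicator {1<..} t * (k t / t)) \<partial>lborel) < \<infinity>" .
  show ?thesis unfolding k_def[symmetric]
  proof (rule integrableI_nonneg[OF _ _ fin])
    show "(\<lambda>t. indicator {1<..} t * (k t / t)) \<in> borel_measurable lborel"
      unfolding eq using kk by measurable
    show "AE t in lborel. 0 \<le> indicator {1<..} t * (k t / t)"
      using completely_monotone_nonneg[OF k] by (auto simp: indicator_def)
  qed
qed

text \<open>Were k bounded below by e > 0, its Levy integral over (1, N) would be at least e log N,
  which is unbounded in N. Hence k takes a value below any e, and monotonicity keeps it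
  there.\<close>

lemma completely_monotone_tendsto_zero:
  assumes k: "completely_monotone k"
    and int: "set_integrable lborel {0<..} (\<lambda>t. min 1 t * (k t / t))"
  shows "(k \<longlongrightarrow> 0) at_top"
proof (rule order_tendstoI)
  fix e :: real assume e: "e < 0"
  show "eventually (\<lambda>t. e < k t) at_top"
    using eventually_gt_at_top[of 0]
  proof eventually_elim
    case (elim t)
    then show ?case using completely_monotone_nonneg[OF k elim] e by simp
  qed
next
  fix e :: real assume e: "e > 0"
  have "\<exists>t>0. k t < e"
  proof (rule ccontr)
    assume "\<not> (\<exists>t>0. k t < e)"
    then have ge: "k t \<ge> e" if "t > 0" for t using that by (meson not_le)
    define C where "C = (\<integral>t. indicator {0<..} t *\<^sub>R (min 1 t * (k t / t)) \<partial>lborel)"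
    have C: "(\<integral>\<^sup>+t. ennreal (indicator {0<..} t *\<^sub>R (min 1 t * (k t / t))) \<partial>lborel) = ennreal C"
      unfolding C_def using int
      by (intro nn_integral_eq_integral)
         (auto simp: set_integrable_def indicator_def completely_monotone_nonneg[OF k])
    have C0: "C \<ge> 0" unfolding C_def
      by (intro Bochner_Integration.integral_nonneg) (auto simp: indicator_def completely_monotone_nonneg[OF k])
    \<comment> \<open>Chosen so that e log N = C + 1, just above the total Levy integral C.\<close>
    define N where "N = exp ((C + 1) / e)"
    have "ennreal (e * max 0 (ln N)) = ennreal e * (\<integral>\<^sup>+t. ennreal (indicator {1<..<N} t / t) \<partial>lborel)"
      using e by (subst nn_integral_inverse_Ioo) (auto simp: N_def ennreal_mult')
    also have "\<dots> = (\<integral>\<^sup>+t. ennreal (e * (indicator {1<..<N} t / t)) \<partial>lborel)"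
      using e by (subst nn_integral_cmult[symmetric]) (auto simp: ennreal_mult'[symmetric])
    also have "\<dots> \<le> (\<integral>\<^sup>+t. ennreal (indicator {0<..} t *\<^sub>R (min 1 t * (k t / t))) \<partial>lborel)"
    proof (intro nn_integral_mono ennreal_leI)
      fix t :: real
      show "e * (indicator {1<..<N} t / t) \<le> indicator {0<..} t *\<^sub>R (min 1 t * (k t / t))"
        using ge[of t] e completely_monotone_nonneg[OF k, of t]
        by (cases "t > 1") (auto simp: indicator_def divide_right_mono)
    qed
    finally have "e * max 0 (ln N) \<le> C" using C C0 by simp
    then show False using e C0 by (simp add: N_def)
  qed
  then obtain t where t: "t > 0" "k t < e" by blast
  show "eventually (\<lambda>s. k s < e) at_top"
    using eventually_ge_at_top[of t]
  proof eventually_elim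
    case (elim s)
    then show ?case using completely_monotone_antimono[OF k t(1) elim] t(2) by simp
  qed
qed

text \<open>Two forms are needed: the one in [0, \<infinity>] enters the Tonelli identity before
  anything is known about integrability of k', the Bochner one enters the integral equation.\<close>

lemma tail_integral_uminus_deriv:
  assumes k: "completely_monotone k"
    and int: "set_integrable lborel {0<..} (\<lambda>t. min 1 t * (k t / t))" and t: "t > 0"
  shows "(\<integral>\<^sup>+x. ennreal (indicator {t<..} x * (- deriv k x)) \<partial>lborel) = ennreal (k t)"
    and "(LINT x:{t<..}|lborel. - deriv k x) = k t"
proof -
  let ?m = "\<lambda>x. - deriv k x"
  have m: "completely_monotone ?m" by (rule completely_monotone_uminus_deriv[OF k])
  let ?h = "\<lambda>x. indicator {0<..} x * ?m x"
  have hm: "?h \<in> borel_measurable borel" using completely_monotone_measurable[OF m] .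
  have "(\<integral>\<^sup>+x. ennreal (?h x) * indicator {t..} x \<partial>lborel) = ennreal (0 - (- k t))"
  proof (rule nn_integral_FTC_atLeast[OF hm])
    fix x assume "t \<le> x"
    with t have x: "x > 0" by simp
    show "((\<lambda>x. - k x) has_real_derivative ?h x) (at x)"
      using completely_monotone_has_derivative[OF k x] x by (auto intro!: derivative_eq_intros)
    show "0 \<le> ?h x" using completely_monotone_nonneg[OF m x] x by simp
  next
    show "((\<lambda>x. - k x) \<longlongrightarrow> 0) at_top"
      using tendsto_minus[OF completely_monotone_tendsto_zero[OF k int]] by simp
  qed
  moreover have "(\<integral>\<^sup>+x. ennreal (?h x) * indicator {t..} x \<partial>lborel) = (\<integral>\<^sup>+x. ennreal (indicator {t<..} x * ?m x) \<partial>lborel)"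
    by (rule nn_integral_cong_AE, use AE_lborel_singleton[of t] in eventually_elim)
       (use t in \<open>auto simp: indicator_def\<close>)
  ultimately show *: "(\<integral>\<^sup>+x. ennreal (indicator {t<..} x * ?m x) \<partial>lborel) = ennreal (k t)" by simp
  have "(\<lambda>x. indicator {t<..} x * ?h x) \<in> borel_measurable borel"
    using hm by measurable
  also have "(\<lambda>x. indicator {t<..} x * ?h x) = (\<lambda>x. indicator {t<..} x * ?m x)"
    using t by (auto simp: indicator_def)
  finally have "(\<lambda>x. indicator {t<..} x * ?m x) \<in> borel_measurable lborel" by simp
  moreover have "AE x in lborel. 0 \<le> indicator {t<..} x * ?m x"
    using completely_monotone_nonneg[OF m] t by (auto simp: indicator_def)
  ultimately have "(\<integral>x. indicator {t<..} x * ?m x \<partial>lborel) = enn2real (\<integral>\<^sup>+x. ennreal (indicator {t<..} x * ?m x) \<partial>lborel)"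
    by (rule integral_eq_nn_integral)
  then show "(LINT x:{t<..}|lborel. ?m x) = k t"
    unfolding * set_lebesgue_integral_def using completely_monotone_nonneg[OF k t] by simp
qed

lemma log_integrable_uminus_deriv:
  assumes k: "completely_monotone k"
    and int: "set_integrable lborel {0<..} (\<lambda>t. min 1 t * (k t / t))"
  shows "set_integrable lborel {0<..} (\<lambda>x. max 0 (ln x) * (- deriv k x))"
proof -
  let ?m = "\<lambda>x. - deriv k x"
  have m: "completely_monotone ?m" by (rule completely_monotone_uminus_deriv[OF k])
  define h where "h x = indicator {0<..} x * ?m x" for x
  have h_meas [measurable]: "h \<in> borel_measurable borel"
    unfolding h_def using completely_monotone_measurable[OF m] by simp
  have h: "h x \<ge> 0" for x unfolding h_def using completely_monotone_nonneg[OF m] by (auto simp: indicator_def)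
  have "(\<integral>\<^sup>+x. ennreal (max 0 (ln x) * h x) \<partial>lborel) = 
     (\<integral>\<^sup>+t. ennreal (indicator {1<..} t / t) * (\<integral>\<^sup>+x. ennreal (indicator {t<..} x * h x) \<partial>lborel) \<partial>lborel)"
    by (rule nn_integral_log_weight[OF h_meas h, symmetric]) (simp add: h_def)
  \<comment> \<open>For t > 1 the two integrands agree, as min(1,t) = 1; the part over (0,1] only
    adds to the right-hand side.\<close>
  also have "\<dots> \<le> (\<integral>\<^sup>+t. ennreal (indicator {0<..} t *\<^sub>R (min 1 t * (k t / t))) \<partial>lborel)"
  proof (rule nn_integral_mono)
    fix t :: real
    show "ennreal (indicator {1<..} t / t) * (\<integral>\<^sup>+x. ennreal (indicator {t<..} x * h x) \<partial>lborel)
      \<le> ennreal (indicator {0<..} t *\<^sub>R (min 1 t * (k t / t)))"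
    proof (cases "t > 1")
      case True
      have "indicator {t<..} x * h x = indicator {t<..} x * ?m x" for x
        using True by (auto simp: h_def indicator_def)
      then have "(\<integral>\<^sup>+x. ennreal (indicator {t<..} x * h x) \<partial>lborel) = ennreal (k t)"
        using tail_integral_uminus_deriv(1)[OF k int, of t] True by simp
      then show ?thesis using True completely_monotone_nonneg[OF k, of t]
        by (simp add: ennreal_mult'[symmetric])
    qed simp
  qed
  also have "\<dots> < \<infinity>" using int unfolding set_integrable_def
    by (subst nn_integral_eq_integral) (auto simp: indicator_def completely_monotone_nonneg[OF k])
  finally have "integrable lborel (\<lambda>x. max 0 (ln x) * h x)"
    by (intro integrableI_nonneg) (use h in auto)
  moreover have "(\<lambda>x. max 0 (ln x) * h x) = (\<lambda>x. indicator {0<..} x *\<^sub>R (max 0 (ln x) * ?m x))"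
    by (auto simp: h_def indicator_def)
  ultimately show ?thesis by (simp only: set_integrable_def)
qed

subsection \<open>Laplace transforms and convolutions\<close>

lemma not_AE_lborel_notin_interval:
  fixes c d :: real
  assumes "c < d"
  shows "\<not> (AE x in lborel. x \<notin> {c<..<d})"
proof
  assume "AE x in lborel. x \<notin> {c<..<d}"
  then have "{c<..<d} \<in> null_sets lborel" by (subst AE_iff_null_sets) auto
  then show False using assms by (simp add: null_sets_def)
qed

text \<open>
  In the variable $y = e^{-x} \in [0,1]$ the hypotheses say that all moments of a finite signed
  measure vanish, so by Weierstrass approximation its integrals against continuous functions do.
\<close>
lemma laplace_transform_eq_zero:
  fixes g :: "real \<Rightarrow> real"
  assumes a: "a \<ge> 0" and cont: "continuous_on {a<..} g" and neg: "\<And>x. x < a \<Longrightarrow> g x = 0"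
    and int: "\<And>u. u > 0 \<Longrightarrow> integrable lborel (\<lambda>x. exp (- u * x) * g x)"
    and zero: "\<And>u. u > 0 \<Longrightarrow> (\<integral>x. exp (- u * x) * g x \<partial>lborel) = 0"
    and t: "t > a"
  shows "g t = 0"
proof (rule ccontr)
  \<comment> \<open>One exponential is absorbed because g itself need not be integrable: the moment
    of order i of G in exp(-x) is then the transform of g at i + 1, which is positive also for i =
    0.\<close>
  define G where "G x = exp (- x) * g x" for x
  have G_int: "integrable lborel G" using int[of 1] by (simp add: G_def[abs_def])
  then have [measurable]: "G \<in> borel_measurable borel" by simp
  have poly: "integrable lborel (\<lambda>x. p (exp (- x)) * G x)" "(\<integral>x. p (exp (- x)) * G x \<partial>lborel) = 0"
    if p: "real_polynomial_function p" for p
  proof -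
    obtain c n where p': "p = (\<lambda>y. \<Sum>i\<le>n. c i * y ^ i)"
      using p unfolding real_polynomial_function_iff_sum by blast
    have eq: "p (exp (- x)) * G x = (\<Sum>i\<le>n. c i * (exp (- (real i + 1) * x) * g x))" for x
      unfolding p' G_def sum_distrib_right
      by (rule sum.cong) (auto simp: exp_of_nat_mult[symmetric] exp_add[symmetric] algebra_simps simp flip: exp_of_nat_mult)
    show "integrable lborel (\<lambda>x. p (exp (- x)) * G x)" unfolding eq
      by (intro Bochner_Integration.integrable_sum integrable_mult_right int) simp
    have "(\<integral>x. p (exp (- x)) * G x \<partial>lborel)
        = (\<Sum>i\<le>n. \<integral>x. c i * (exp (- (real i + 1) * x) * g x) \<partial>lborel)"
      unfolding eq by (intro Bochner_Integration.integral_sum integrable_mult_right int) simp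
    also have "\<dots> = (\<Sum>i\<le>n. c i * (\<integral>x. exp (- (real i + 1) * x) * g x \<partial>lborel))"
      by (simp only: integral_mult_right_zero)
    also have "\<dots> = 0"
      by (intro sum.neutral ballI) (subst zero, simp_all)
    finally show "(\<integral>x. p (exp (- x)) * G x \<partial>lborel) = 0" .
  qed
  have cts: "integrable lborel (\<lambda>x. \<phi> (exp (- x)) * G x) \<and> (\<integral>x. \<phi> (exp (- x)) * G x \<partial>lborel) = 0"
    if \<phi>: "continuous_on UNIV \<phi>" for \<phi> :: "real \<Rightarrow> real"
  proof -
    have [measurable]: "\<phi> \<in> borel_measurable borel" using \<phi> by (rule borel_measurable_continuous_onI)
    have approx: "integrable lborel (\<lambda>x. \<phi> (exp (- x)) * G x) \<and>
        \<bar>\<integral>x. \<phi> (exp (- x)) * G x \<partial>lborel\<bar> \<le> e * (\<integral>x. \<bar>G x\<bar> \<partial>lborel)" if e: "e > 0" for e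
    proof -
      obtain p where p: "real_polynomial_function p" "\<And>y. y \<in> {0..1} \<Longrightarrow> \<bar>\<phi> y - p y\<bar> < e"
        using Stone_Weierstrass_real_polynomial_function[of "{0..1}" \<phi> e] \<phi> e
        by (auto intro: continuous_on_subset)
      note P = poly[OF p(1)]
      have [measurable]: "(\<lambda>x. p (exp (- x)) * G x) \<in> borel_measurable borel"
        using P(1) by simp
      have bd: "\<bar>\<phi> (exp (- x)) * G x - p (exp (- x)) * G x\<bar> \<le> e * \<bar>G x\<bar>" for x
      \<comment> \<open>The polynomial is close to \<phi> only on [0,1], and exp(-x) lies there for
        x \<ge> a \<ge> 0; to the left of a the factor \<open>G x\<close> is 0.\<close>
      proof (cases "x < a")
        case True
        then show ?thesis using neg by (simp add: G_def)
      next
        case False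
        then have "\<bar>\<phi> (exp (- x)) - p (exp (- x))\<bar> \<le> e"
          using p(2)[of "exp (- x)"] a by simp
        then have "\<bar>\<phi> (exp (- x)) - p (exp (- x))\<bar> * \<bar>G x\<bar> \<le> e * \<bar>G x\<bar>"
          by (rule mult_right_mono) simp
        then show ?thesis by (simp add: abs_mult[symmetric] algebra_simps)
      qed
      have D: "integrable lborel (\<lambda>x. \<phi> (exp (- x)) * G x - p (exp (- x)) * G x)"
      proof (rule Bochner_Integration.integrable_bound[of _ "\<lambda>x. e * \<bar>G x\<bar>"])
        show "AE x in lborel. norm (\<phi> (exp (- x)) * G x - p (exp (- x)) * G x) \<le> norm (e * \<bar>G x\<bar>)"
          using bd e by (simp add: abs_mult)
      qed (use G_int in auto)
      have I: "integrable lborel (\<lambda>x. \<phi> (exp (- x)) * G x)"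
        using Bochner_Integration.integrable_add[OF D P(1)] by simp
      have "(\<integral>x. \<phi> (exp (- x)) * G x \<partial>lborel) = (\<integral>x. \<phi> (exp (- x)) * G x - p (exp (- x)) * G x \<partial>lborel)"
        using P I by simp
      also have "\<bar>\<dots>\<bar> \<le> (\<integral>x. \<bar>\<phi> (exp (- x)) * G x - p (exp (- x)) * G x\<bar> \<partial>lborel)"
        by (rule integral_abs_bound)
      also have "\<dots> \<le> (\<integral>x. e * \<bar>G x\<bar> \<partial>lborel)"
        by (rule integral_mono) (use D G_int bd in auto)
      finally show ?thesis using I by simp
    qed
    define J where "J = (\<integral>x. \<bar>G x\<bar> \<partial>lborel)"
    have J: "J \<ge> 0" unfolding J_def by simp
    have "\<bar>\<integral>x. \<phi> (exp (- x)) * G x \<partial>lborel\<bar> \<le> 0"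
    proof (rule field_le_epsilon)
      fix e :: real assume e: "e > 0"
      \<comment> \<open>Dividing by J + 1 instead of J allows J = 0.\<close>
      have "e / (J + 1) * J \<le> e" using J e by (simp add: field_simps)
      then show "\<bar>\<integral>x. \<phi> (exp (- x)) * G x \<partial>lborel\<bar> \<le> 0 + e"
        using approx[of "e / (J + 1)"] J e unfolding J_def[symmetric] by (auto intro: order_trans)
    qed
    then show ?thesis using approx[of 1] by simp
  qed
  assume nz: "g t \<noteq> 0"
  have "isCont g t" using cont t by (simp add: continuous_on_eq_continuous_at)
  \<comment> \<open>Multiplying by \<open>g t\<close> treats both signs of \<open>g t\<close>
    together.\<close>
  then have "isCont (\<lambda>x. g x * g t) t" by (intro continuous_intros)
  moreover have "g t * g t > 0" using nz by (metis not_real_square_gt_zero)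
  ultimately obtain d where d: "d > 0" "\<And>x. dist x t < d \<Longrightarrow> g x * g t > 0"
    by (auto dest!: order_tendstoD(1)[OF isContD] simp: eventually_at) (metis dist_self)
  \<comment> \<open>A continuous bump in y = exp(-x), positive exactly for x in (t - d, t + d).
    Against it, g times \<open>g t\<close> has a nonnegative integrand that is positive on this
    interval, yet integral 0.\<close>
  define \<phi> where "\<phi> y = max 0 (exp (- (t - d)) - y) * max 0 (y - exp (- (t + d)))" for y :: real
  have "continuous_on UNIV \<phi>" unfolding \<phi>_def by (intro continuous_intros)
  note C = cts[OF this]
  have pos: "\<phi> (exp (- x)) * G x * g t > 0" if "x \<in> {t - d<..<t + d}" for x
  proof -
    have "g x * g t > 0" using that by (intro d(2)) (auto simp: dist_real_def)
    moreover have "\<phi> (exp (- x)) > 0" using that by (simp add: \<phi>_def)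
    ultimately have "\<phi> (exp (- x)) * (exp (- x) * (g x * g t)) > 0" by simp
    then show ?thesis by (simp add: G_def mult.assoc)
  qed
  have out: "\<phi> (exp (- x)) = 0" if "x \<notin> {t - d<..<t + d}" for x
    using that by (auto simp: \<phi>_def max_def)
  have "(\<integral>x. \<phi> (exp (- x)) * G x * g t \<partial>lborel) = 0" "integrable lborel (\<lambda>x. \<phi> (exp (- x)) * G x * g t)"
    using C by auto
  moreover have "AE x in lborel. 0 \<le> \<phi> (exp (- x)) * G x * g t"
    using pos out by (intro AE_I2) (metis less_imp_le mult_zero_left order_refl)
  ultimately have "AE x in lborel. \<phi> (exp (- x)) * G x * g t = 0"
    by (simp only: integral_nonneg_eq_0_iff_AE)
  then have "AE x in lborel. x \<notin> {t - d<..<t + d}"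
    by eventually_elim (use pos in \<open>metis less_irrefl\<close>)
  then show False using not_AE_lborel_notin_interval[of "t - d" "t + d"] d by simp
qed

text \<open>Tonelli and the shift t = s + x split the exponential. Convergence of the convolution is
  asked at every t because a divergent Bochner integral would be 0 and no longer match the inner
  integral in [0, \<infinity>].\<close>

lemma has_bochner_integral_laplace_convolution:
  fixes f k :: "real \<Rightarrow> real"
  assumes [measurable]: "f \<in> borel_measurable borel" "k \<in> borel_measurable borel"
    and f: "\<And>x. f x \<ge> 0" and k: "\<And>x. k x \<ge> 0"
    and conv: "\<And>t. integrable lborel (\<lambda>s. f s * k (t - s))"
    and fi: "integrable lborel (\<lambda>x. exp (- u * x) * f x)"
    and ki: "integrable lborel (\<lambda>x. exp (- u * x) * k x)"
  shows "has_bochner_integral lborel (\<lambda>t. exp (- u * t) * (\<integral>s. f s * k (t - s) \<partial>lborel))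
    ((\<integral>x. exp (- u * x) * f x \<partial>lborel) * (\<integral>x. exp (- u * x) * k x \<partial>lborel))"
proof (rule has_bochner_integral_nn_integral)
  have "(\<integral>\<^sup>+t. ennreal (exp (- u * t) * (\<integral>s. f s * k (t - s) \<partial>lborel)) \<partial>lborel)
    = (\<integral>\<^sup>+t. \<integral>\<^sup>+s. ennreal (exp (- u * t) * (f s * k (t - s))) \<partial>lborel \<partial>lborel)"
  proof (rule nn_integral_cong)
    fix t
    show "ennreal (exp (- u * t) * (\<integral>s. f s * k (t - s) \<partial>lborel)) =
        (\<integral>\<^sup>+s. ennreal (exp (- u * t) * (f s * k (t - s))) \<partial>lborel)"
      by (subst nn_integral_eq_integral) (use conv[of t] f k in auto)
  qed
  also have "\<dots> = (\<integral>\<^sup>+s. \<integral>\<^sup>+t. ennreal (exp (- u * t) * (f s * k (t - s))) \<partial>lborel \<partial>lborel)"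
    by (rule lborel_pair.Fubini') measurable
  also have "\<dots> = (\<integral>\<^sup>+s. ennreal (exp (- u * s) * f s) * (\<integral>\<^sup>+x. ennreal (exp (- u * x) * k x) \<partial>lborel) \<partial>lborel)"
  proof (rule nn_integral_cong)
    fix s
    have "(\<integral>\<^sup>+t. ennreal (exp (- u * t) * (f s * k (t - s))) \<partial>lborel)
      = (\<integral>\<^sup>+x. ennreal (exp (- u * (s + x)) * (f s * k x)) \<partial>lborel)"
      by (subst nn_integral_real_affine[where c = 1 and t = s]) auto
    also have "\<dots> = (\<integral>\<^sup>+x. ennreal (exp (- u * s) * f s) * ennreal (exp (- u * x) * k x) \<partial>lborel)"
    proof (rule nn_integral_cong)
      fix x
      have "exp (- u * (s + x)) = exp (- u * s) * exp (- u * x)"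
        by (simp add: exp_add[symmetric] algebra_simps)
      then show "ennreal (exp (- u * (s + x)) * (f s * k x)) =
          ennreal (exp (- u * s) * f s) * ennreal (exp (- u * x) * k x)"
        by (simp add: ennreal_mult[symmetric] f k mult_ac)
    qed
    also have "\<dots> = ennreal (exp (- u * s) * f s) * (\<integral>\<^sup>+x. ennreal (exp (- u * x) * k x) \<partial>lborel)"
      by (rule nn_integral_cmult) measurable
    finally show "(\<integral>\<^sup>+t. ennreal (exp (- u * t) * (f s * k (t - s))) \<partial>lborel) = \<dots>" .
  qed
  also have "\<dots> = ennreal (\<integral>x. exp (- u * x) * f x \<partial>lborel) * ennreal (\<integral>x. exp (- u * x) * k x \<partial>lborel)"
    by (subst nn_integral_multc, measurable) (simp add: nn_integral_eq_integral fi[simplified] ki[simplified] f k)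
  finally show "(\<integral>\<^sup>+t. ennreal (exp (- u * t) * (\<integral>s. f s * k (t - s) \<partial>lborel)) \<partial>lborel) =
    ennreal ((\<integral>x. exp (- u * x) * f x \<partial>lborel) * (\<integral>x. exp (- u * x) * k x \<partial>lborel))"
    by (subst ennreal_mult) (auto simp: f k)
qed (auto simp: f k)

text \<open>Split k at d into \<open>k1\<close>, bounded by \<open>k d\<close>, and
  \<open>k2\<close>, which carries the singularity at 0. With \<open>k1\<close> the variable of f is
  kept, so that f times \<open>k d\<close> dominates even if f is unbounded near a. With
  \<open>k2\<close> one substitutes x = t - s, so that f is evaluated only on a compact interval
  inside (a, \<infinity>), and B times k on (0,1) dominates.\<close>

lemma
  fixes f k :: "real \<Rightarrow> real"
  assumes [measurable]: "k \<in> borel_measurable borel"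
    and f: "\<And>x. f x \<ge> 0" "integrable lborel f" "continuous_on {a<..} f"
    and k: "\<And>x. k x \<ge> 0" "\<And>x. x \<le> 0 \<Longrightarrow> k x = 0" "continuous_on {0<..} k"
      "\<And>x y. 0 < x \<Longrightarrow> x \<le> y \<Longrightarrow> k y \<le> k x" "integrable lborel (\<lambda>x. indicator {0<..<1} x * k x)"
    and t0: "t0 > a"
  shows integrable_convolution: "integrable lborel (\<lambda>s. f s * k (t0 - s))"
    and isCont_convolution: "isCont (\<lambda>t. \<integral>s. f s * k (t - s) \<partial>lborel) t0"
proof -
  have [measurable]: "f \<in> borel_measurable borel" using f(2) by simp
  \<comment> \<open>For t within d of \<open>t0\<close> and 0 < x < d, the point t - x exceeds t0 -
    2d, which is greater than a. The cap at 1 keeps the support of \<open>k2\<close> inside the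
    interval where k is assumed integrable.\<close>
  define d where "d = min 1 ((t0 - a) / 4)"
  have d: "d > 0" "d \<le> 1" "4 * d \<le> t0 - a" using t0 by (auto simp: d_def min_def)
  define S where "S = {t0 - d<..<t0 + d}"
  define k1 where "k1 x = indicator {d..} x * k x" for x
  define k2 where "k2 x = indicator {0<..<d} x * k x" for x
  have [measurable]: "k1 \<in> borel_measurable borel" "k2 \<in> borel_measurable borel"
    unfolding k1_def k2_def by measurable
  have k12: "k x = k1 x + k2 x" for x
    using d k(2)[of x] by (auto simp: k1_def k2_def indicator_def)
  have k1_bd: "0 \<le> k1 x" "k1 x \<le> k d" for x
    using k(1)[of x] k(1)[of d] k(4)[of d x] d by (auto simp: k1_def indicator_def)
  have k1_cont: "isCont k1 x" if "x \<noteq> d" for x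
  proof (cases "x < d")
    case True
    then have "eventually (\<lambda>y. y \<in> {..<d}) (nhds x)" by (intro eventually_nhds_in_open) auto
    then have "eventually (\<lambda>y. k1 y = 0) (nhds x)" by eventually_elim (simp add: k1_def)
    then show ?thesis by (simp add: isCont_cong)
  next
    case False
    with that have "eventually (\<lambda>y. y \<in> {d<..}) (nhds x)" by (intro eventually_nhds_in_open) auto
    then have "eventually (\<lambda>y. k1 y = k y) (nhds x)" by eventually_elim (simp add: k1_def)
    moreover have "isCont k x" using False k(3) d by (simp add: continuous_on_eq_continuous_at)
    ultimately show ?thesis by (simp add: isCont_cong)
  qed
  have "compact (f ` {t0 - 2 * d..t0 + d})"
    using f(3) d by (intro compact_continuous_image) (auto intro: continuous_on_subset)
  then obtain B where B: "\<And>x. x \<in> {t0 - 2 * d..t0 + d} \<Longrightarrow> f x \<le> B"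
    using compact_imp_bounded bounded_pos by (metis abs_le_D1 image_eqI real_norm_def)
  have f_lim: "isCont f x" if "x > a" for x
    using f(3) that by (simp add: continuous_on_eq_continuous_at)
  have w1: "integrable lborel (\<lambda>s. f s * k d)" using f(2) by simp
  have w2: "integrable lborel (\<lambda>x. B * (indicator {0<..<1} x * k x))" using k(5) by simp
  have bd1: "\<bar>f s * k1 (t - s)\<bar> \<le> f s * k d" for s t
    using f(1)[of s] k1_bd[of "t - s"] by (simp add: abs_mult mult_left_mono)
  have bd2: "\<bar>f (t - x) * k2 x\<bar> \<le> B * (indicator {0<..<1} x * k x)" if "t \<in> S" for t x
  proof (cases "x \<in> {0<..<d}")
    case True
    then have "f (t - x) \<le> B" using that by (intro B) (auto simp: S_def)
    then show ?thesis using True d f(1)[of "t - x"] k(1)[of x]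
      by (simp add: k2_def abs_mult mult_right_mono)
  next
    case False
    have "0 \<le> B" using f(1)[of t0] B[of t0] d by simp
    then show ?thesis using False k(1)[of x] by (auto simp: k2_def)
  qed
  have i1: "integrable lborel (\<lambda>s. f s * k1 (t - s))" for t
    by (rule Bochner_Integration.integrable_bound[OF w1]) (use bd1 f(1) k(1) in \<open>auto simp: abs_mult\<close>)
  have i2: "integrable lborel (\<lambda>x. f (t - x) * k2 x)" if "t \<in> S" for t
  proof (rule Bochner_Integration.integrable_bound[OF w2])
    show "AE x in lborel. norm (f (t - x) * k2 x) \<le> norm (B * (indicator {0<..<1} x * k x))"
      using bd2[OF that] by (intro AE_I2) (simp, meson abs_ge_self order_trans)
  qed auto
  have i2': "integrable lborel (\<lambda>s. f s * k2 (t - s))" if "t \<in> S" for t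
    using lborel_integrable_real_affine[OF i2[OF that], of "-1" t] by simp
  have conv: "(\<integral>s. f s * k (t - s) \<partial>lborel) = (\<integral>s. f s * k1 (t - s) \<partial>lborel) + (\<integral>x. f (t - x) * k2 x \<partial>lborel)"
    if "t \<in> S" for t
  proof -
    have "(\<integral>s. f s * k (t - s) \<partial>lborel) = (\<integral>s. f s * k1 (t - s) \<partial>lborel) + (\<integral>s. f s * k2 (t - s) \<partial>lborel)"
      using i1 i2'[OF that] by (simp add: k12 distrib_left)
    also have "(\<integral>s. f s * k2 (t - s) \<partial>lborel) = (\<integral>x. f (t - x) * k2 x \<partial>lborel)"
      by (subst lborel_integral_real_affine[where c = "-1" and t = t]) auto
    finally show ?thesis .
  qed
  have t0S: "t0 \<in> S" using d by (simp add: S_def)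
  show "integrable lborel (\<lambda>s. f s * k (t0 - s))"
    using Bochner_Integration.integrable_add[OF i1 i2'[OF t0S]] by (simp add: k12 distrib_left)
  have "((\<lambda>t. \<integral>s. f s * k1 (t - s) \<partial>lborel) \<longlongrightarrow> (\<integral>s. f s * k1 (t0 - s) \<partial>lborel)) (at t0 within S)"
  proof (rule tendsto_integral_dominated_within[OF _ _ w1])
    show "AE s in lborel. ((\<lambda>t. f s * k1 (t - s)) \<longlongrightarrow> f s * k1 (t0 - s)) (at t0 within S)"
      \<comment> \<open>The cut makes \<open>k1\<close> jump at d, which disturbs the limit only at
        the single point s = t0 - d.\<close>
      using AE_lborel_singleton[of "t0 - d"]
    proof eventually_elim
      case (elim s)
      then have "isCont k1 (t0 - s)" by (intro k1_cont) auto
      then have "((\<lambda>t. k1 (t - s)) \<longlongrightarrow> k1 (t0 - s)) (at t0 within S)"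
        by (rule isCont_tendsto_compose) (intro tendsto_intros)
      then show ?case by (intro tendsto_intros)
    qed
  qed (use bd1 in auto)
  moreover have "((\<lambda>t. \<integral>x. f (t - x) * k2 x \<partial>lborel) \<longlongrightarrow> (\<integral>x. f (t0 - x) * k2 x \<partial>lborel)) (at t0 within S)"
  proof (rule tendsto_integral_dominated_within[OF _ _ w2])
    show "AE x in lborel. ((\<lambda>t. f (t - x) * k2 x) \<longlongrightarrow> f (t0 - x) * k2 x) (at t0 within S)"
    proof (rule AE_I2)
      fix x
      show "((\<lambda>t. f (t - x) * k2 x) \<longlongrightarrow> f (t0 - x) * k2 x) (at t0 within S)"
      proof (cases "x \<in> {0<..<d}")
        case True
        then have "isCont f (t0 - x)" using d by (intro f_lim) auto
        then have "((\<lambda>t. f (t - x)) \<longlongrightarrow> f (t0 - x)) (at t0 within S)"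
          by (rule isCont_tendsto_compose) (intro tendsto_intros)
        then show ?thesis by (intro tendsto_intros)
      qed (simp add: k2_def)
    qed
  qed (use bd2 in auto)
  ultimately have "((\<lambda>t. (\<integral>s. f s * k1 (t - s) \<partial>lborel) + (\<integral>x. f (t - x) * k2 x \<partial>lborel))
      \<longlongrightarrow> (\<integral>s. f s * k (t0 - s) \<partial>lborel)) (at t0 within S)"
    unfolding conv[OF t0S] by (rule tendsto_add)
  then have "((\<lambda>t. \<integral>s. f s * k (t - s) \<partial>lborel) \<longlongrightarrow> (\<integral>s. f s * k (t0 - s) \<partial>lborel)) (at t0 within S)"
    by (rule Lim_transform_eventually) (auto simp: eventually_at_filter conv)
  moreover have "at t0 within S = at t0" using t0S by (intro at_within_open) (auto simp: S_def)
  ultimately show "isCont (\<lambda>t. \<integral>s. f s * k (t - s) \<partial>lborel) t0" by (simp add: isCont_def)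
qed

subsection \<open>The functional equation of the density\<close>

text \<open>The exponent without its drift, with the Levy density cut off to the whole line so that
  it has the form required of the weight g.\<close>

definition laplace_exponent :: "(real \<Rightarrow> real) \<Rightarrow> real \<Rightarrow> real" where
  "laplace_exponent k u = (\<integral>t. (1 - exp (- u * t)) * (indicator {0<..} t * (k t / t)) \<partial>lborel)"

lemma laplace_exponent_eq:
  "laplace_exponent k u = (LINT t:{0<..}|lborel. (1 - exp (- u * t)) * (k t / t))"
  unfolding laplace_exponent_def set_lebesgue_integral_def by (simp add: mult.left_commute)

lemma laplace_exponent_0: "laplace_exponent k 0 = 0"
  by (simp add: laplace_exponent_def)

context
  fixes k :: "real \<Rightarrow> real"
  assumes k_cm: "completely_monotone k"
    and k_int: "set_integrable lborel {0<..} (\<lambda>t. min 1 t * (k t / t))"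
begin

lemma levy_density_measurable: "(\<lambda>t. indicator {0<..} t * (k t / t)) \<in> borel_measurable borel"
proof -
  have "(\<lambda>t. (indicator {0<..} t * k t) / t) \<in> borel_measurable borel"
    using completely_monotone_measurable[OF k_cm] by measurable
  then show ?thesis by simp
qed

lemma levy_density_properties:
  "indicator {0<..} t * (k t / t) \<ge> 0"
  "t < 0 \<Longrightarrow> indicator {0<..} t * (k t / t) = 0"
  "integrable lborel (\<lambda>t. min 1 t * (indicator {0<..} t * (k t / t)))"
  using k_int completely_monotone_nonneg[OF k_cm, of t]
  by (auto simp: set_integrable_def indicator_def mult.left_commute)

text \<open>Differentiating the exponent brings down a factor t, which cancels the 1/t of the Levy
  density: the derivative is the Laplace transform of k.\<close>

lemma mult_exp_levy_density:
  "t * exp (- u * t) * (indicator {0<..} t * (k t / t)) = exp (- u * t) * (indicator {0<..} t * k t)"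
  by (simp add: indicator_def)

lemma laplace_exponent_has_derivative:
  assumes "u > 0"
  shows "(laplace_exponent k has_real_derivative (\<integral>t. exp (- u * t) * (indicator {0<..} t * k t) \<partial>lborel)) (at u)"
  using has_real_derivative_integral_one_minus_exp[OF levy_density_measurable levy_density_properties assms]
  unfolding laplace_exponent_def[abs_def] mult_exp_levy_density .

lemma continuous_on_laplace_exponent: "continuous_on {0..} (laplace_exponent k)"
  using continuous_on_integral_one_minus_exp[OF levy_density_measurable levy_density_properties]
  unfolding laplace_exponent_def[abs_def] .

lemma laplace_exponent_over_tendsto: "((\<lambda>u. laplace_exponent k u / u) \<longlongrightarrow> 0) at_top"
  using tendsto_integral_one_minus_exp_over[OF levy_density_measurable levy_density_properties]
  unfolding laplace_exponent_def[abs_def] .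

lemma integrable_laplace_kernel:
  "u > 0 \<Longrightarrow> integrable lborel (\<lambda>t. exp (- u * t) * (indicator {0<..} t * k t))"
  using integrable_mult_exp_mult[OF levy_density_measurable levy_density_properties]
  unfolding mult_exp_levy_density .

lemma integrable_kernel_near_0: "integrable lborel (\<lambda>t. indicator {0<..<1} t * (indicator {0<..} t * k t))"
proof (rule Bochner_Integration.integrable_bound[OF levy_density_properties(3)])
  show "(\<lambda>t. indicator {0<..<1} t * (indicator {0<..} t * k t)) \<in> borel_measurable lborel"
    using completely_monotone_measurable[OF k_cm] by measurable
  show "AE t in lborel. norm (indicator {0<..<1} t * (indicator {0<..} t * k t))
      \<le> norm (min 1 t * (indicator {0<..} t * (k t / t)))"
    by (rule AE_I2) (auto simp: indicator_def abs_mult)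
qed

end

section \<open>The density and its Laplace transform\<close>

context
  fixes a :: real and f :: "real \<Rightarrow> real"
  assumes a: "a \<ge> 0"
    and f_meas [measurable]: "f \<in> borel_measurable borel"
    and f_nonneg: "\<And>t. f t \<ge> 0"
    and f_prob: "(\<integral>\<^sup>+ t. ennreal (f t) \<partial>lborel) = 1"
    and f_supp: "closure {t. f t \<noteq> 0} = {a..}"
    and f_cont: "continuous_on {a<..} f"
begin

lemma density_eq_0: "x < a \<Longrightarrow> f x = 0"
  using f_supp closure_subset[of "{t. f t \<noteq> 0}"] by force

lemma density_integrable: "integrable lborel f" and density_integral: "(\<integral>x. f x \<partial>lborel) = 1"
proof -
  have "has_bochner_integral lborel f 1"
    by (rule has_bochner_integral_nn_integral) (use f_nonneg f_prob in auto)
  then show "integrable lborel f" "(\<integral>x. f x \<partial>lborel) = 1"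
    by (auto simp: has_bochner_integral_iff)
qed

text \<open>An open interval meeting the closure of a set meets the set. This is how the support
  hypothesis is used: to exclude a drift larger than a, and to find a point from which integrability
  of k near 0 can be read off.\<close>

lemma density_pos_somewhere:
  assumes "a \<le> c" "c < d"
  obtains t where "c < t" "t < d" "f t > 0"
proof -
  have "(c + d) / 2 \<in> {c<..<d} \<inter> closure {t. f t \<noteq> 0}" using assms f_supp by auto
  then have "{c<..<d} \<inter> closure {t. f t \<noteq> 0} \<noteq> {}" by blast
  then have "{c<..<d} \<inter> {t. f t \<noteq> 0} \<noteq> {}"
    by (simp only: open_Int_closure_eq_empty[OF open_greaterThanLessThan] not_False_eq_True)
  then obtain t where "c < t" "t < d" "f t \<noteq> 0" by auto
  then show ?thesis using f_nonneg[of t] by (intro that[of t]) auto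
qed

text \<open>Makes f itself an admissible weight g; with \<open>laplace_eq\<close> the facts about g
  then give continuity and the derivative of \<open>laplace\<close>.\<close>

lemma density_min_integrable: "integrable lborel (\<lambda>x. min 1 x * f x)"
proof (rule Bochner_Integration.integrable_bound[OF density_integrable])
  show "AE x in lborel. norm (min 1 x * f x) \<le> norm (f x)"
  proof (rule AE_I2)
    fix x
    show "norm (min 1 x * f x) \<le> norm (f x)"
    proof (cases "x < a")
      case False
      then have "\<bar>min 1 x\<bar> \<le> 1" using a by auto
      then have "\<bar>min 1 x\<bar> * \<bar>f x\<bar> \<le> 1 * \<bar>f x\<bar>" by (rule mult_right_mono) simp
      then show ?thesis by (simp add: abs_mult)
    qed (simp add: density_eq_0)
  qed
qed measurable

definition laplace :: "real \<Rightarrow> real" where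
  "laplace u = (\<integral>x. exp (- u * x) * f x \<partial>lborel)"

lemma exp_mult_density_le:
  assumes "u \<ge> 0"
  shows "exp (- u * x) * f x \<le> exp (- u * a) * f x"
proof (cases "x < a")
  case False
  then have "u * a \<le> u * x" using assms by (intro mult_left_mono) auto
  then show ?thesis by (intro mult_right_mono f_nonneg) simp
qed (simp add: density_eq_0)

lemma laplace_integrable:
  assumes "u \<ge> 0"
  shows "integrable lborel (\<lambda>x. exp (- u * x) * f x)"
proof (rule Bochner_Integration.integrable_bound)
  show "integrable lborel (\<lambda>x. exp (- u * a) * f x)" using density_integrable by simp
  show "AE x in lborel. norm (exp (- u * x) * f x) \<le> norm (exp (- u * a) * f x)"
    using exp_mult_density_le[OF assms] f_nonneg by (simp add: abs_mult)
qed measurable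

lemma laplace_le: "u \<ge> 0 \<Longrightarrow> laplace u \<le> exp (- u * a)"
proof -
  assume u: "u \<ge> 0"
  have "laplace u \<le> (\<integral>x. exp (- u * a) * f x \<partial>lborel)"
    unfolding laplace_def
    by (rule integral_mono) (use laplace_integrable[OF u] density_integrable exp_mult_density_le[OF u] in auto)
  then show ?thesis by (simp add: density_integral)
qed

lemma laplace_eq:
  assumes "u \<ge> 0"
  shows "laplace u = 1 - (\<integral>x. (1 - exp (- u * x)) * f x \<partial>lborel)"
proof -
  have "(\<integral>x. (1 - exp (- u * x)) * f x \<partial>lborel) = (\<integral>x. f x - exp (- u * x) * f x \<partial>lborel)"
    by (simp add: algebra_simps)
  also have "\<dots> = 1 - laplace u"
    unfolding laplace_def
    by (subst Bochner_Integration.integral_diff[OF density_integrable laplace_integrable[OF assms]]) (simp add: density_integral)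
  finally show ?thesis by simp
qed

lemma density_eq_0_neg: "x < 0 \<Longrightarrow> f x = 0"
  using density_eq_0 a by simp

lemma laplace_0: "laplace 0 = 1"
  by (simp add: laplace_def density_integral)

lemma continuous_on_laplace: "continuous_on {0..} laplace"
proof -
  have "continuous_on {0..} (\<lambda>u. 1 - (\<integral>x. (1 - exp (- u * x)) * f x \<partial>lborel))"
    by (intro continuous_intros continuous_on_integral_one_minus_exp[OF f_meas f_nonneg density_eq_0_neg density_min_integrable])
  then show ?thesis by (rule continuous_on_eq) (simp add: laplace_eq)
qed

lemma laplace_has_derivative:
  assumes "u > 0"
  shows "(laplace has_real_derivative - (\<integral>x. x * exp (- u * x) * f x \<partial>lborel)) (at u)"
proof -
  have "((\<lambda>u. 1 - (\<integral>x. (1 - exp (- u * x)) * f x \<partial>lborel)) has_real_derivative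
      0 - (\<integral>x. x * exp (- u * x) * f x \<partial>lborel)) (at u)"
    by (intro derivative_intros has_real_derivative_integral_one_minus_exp[OF f_meas f_nonneg density_eq_0_neg density_min_integrable] assms)
  then have "((\<lambda>u. 1 - (\<integral>x. (1 - exp (- u * x)) * f x \<partial>lborel)) has_real_derivative
      - (\<integral>x. x * exp (- u * x) * f x \<partial>lborel)) (at u)" by simp
  then show ?thesis
    by (rule has_field_derivative_transform_within_open[of _ _ _ "{0<..}"]) (use assms laplace_eq in auto)
qed

lemma integral_eq_laplace:
  "(LINT x:{0..}|density lborel (\<lambda>t. ennreal (f t)). exp (- u * x)) = laplace u"
proof -
  have "(LINT x:{0..}|density lborel (\<lambda>t. ennreal (f t)). exp (- u * x))
    = (\<integral>x. f x * (indicator {0..} x *\<^sub>R exp (- u * x)) \<partial>lborel)"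
    unfolding set_lebesgue_integral_def by (subst integral_real_density) (use f_nonneg in auto)
  also have "\<dots> = laplace u"
    unfolding laplace_def using density_eq_0_neg
    by (intro Bochner_Integration.integral_cong) (auto simp: indicator_def not_le)
  finally show ?thesis .
qed

lemma convolution_eq_0:
  assumes "t \<le> a"
  shows "f s * (indicator {0<..} (t - s) * k (t - s)) = 0"
  using assms density_eq_0[of s] by (cases "s < a") auto

section \<open>Equivalence of the Laplace formula and the convolution equation\<close>

context
  fixes k :: "real \<Rightarrow> real"
  assumes k_cm: "completely_monotone k"
    and k_int: "set_integrable lborel {0<..} (\<lambda>t. min 1 t * (k t / t))"
begin

lemma kernel_properties:
  "(\<lambda>x. indicator {0<..} x * k x) \<in> borel_measurable borel"
  "indicator {0<..} x * k x \<ge> 0"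
  "x \<le> 0 \<Longrightarrow> indicator {0<..} x * k x = 0"
  "continuous_on {0<..} (\<lambda>x. indicator {0<..} x * k x)"
  "0 < x \<Longrightarrow> x \<le> y \<Longrightarrow> indicator {0<..} y * k y \<le> indicator {0<..} x * k x"
proof -
  show "continuous_on {0<..} (\<lambda>x. indicator {0<..} x * k x)"
    using completely_monotone_continuous_on[OF k_cm] by (rule continuous_on_eq) simp
qed (use completely_monotone_measurable[OF k_cm] completely_monotone_nonneg[OF k_cm]
    completely_monotone_antimono[OF k_cm] in \<open>auto simp: indicator_def\<close>)

lemma density_kernel_convolution:
  assumes "t > a"
  shows "integrable lborel (\<lambda>s. f s * (indicator {0<..} (t - s) * k (t - s)))"
    and "isCont (\<lambda>t. \<integral>s. f s * (indicator {0<..} (t - s) * k (t - s)) \<partial>lborel) t"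
  using integrable_convolution[OF kernel_properties(1) f_nonneg density_integrable f_cont kernel_properties(2-5)
      integrable_kernel_near_0[OF k_cm k_int] assms]
    isCont_convolution[OF kernel_properties(1) f_nonneg density_integrable f_cont kernel_properties(2-5)
      integrable_kernel_near_0[OF k_cm k_int] assms]
  by auto

lemma density_kernel_convolution_integrable:
  "integrable lborel (\<lambda>s. f s * (indicator {0<..} (t - s) * k (t - s)))"
proof (cases "t > a")
  case False
  then show ?thesis by (simp only: convolution_eq_0 not_less) simp
qed (rule density_kernel_convolution)

lemma laplace_convolution:
  assumes "u > 0"
  shows "has_bochner_integral lborel
    (\<lambda>t. exp (- u * t) * (\<integral>s. f s * (indicator {0<..} (t - s) * k (t - s)) \<partial>lborel))
    (laplace u * (\<integral>t. exp (- u * t) * (indicator {0<..} t * k t) \<partial>lborel))"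
  unfolding laplace_def
  by (rule has_bochner_integral_laplace_convolution[OF f_meas kernel_properties(1) f_nonneg kernel_properties(2)
        density_kernel_convolution_integrable laplace_integrable integrable_laplace_kernel[OF k_cm k_int]])
     (use assms in auto)

lemma laplace_imp_convolution_equation:
  assumes L: "\<And>u. u \<ge> 0 \<Longrightarrow> laplace u = exp (- (b * u + laplace_exponent k u))" and t: "t > a"
  shows "(t - a) * f t = (\<integral>s. f s * (indicator {0<..} (t - s) * k (t - s)) \<partial>lborel)"
proof -
  define C where "C t = (\<integral>s. f s * (indicator {0<..} (t - s) * k (t - s)) \<partial>lborel)" for t
  define K where "K u = (\<integral>t. exp (- u * t) * (indicator {0<..} t * k t) \<partial>lborel)" for u
  have diff: "(\<integral>x. x * exp (- u * x) * f x \<partial>lborel) = (b + K u) * laplace u" if u: "u > 0" for u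
  proof -
    have "((\<lambda>u. exp (- (b * u + laplace_exponent k u))) has_real_derivative
        - (b + K u) * exp (- (b * u + laplace_exponent k u))) (at u)"
      using laplace_exponent_has_derivative[OF k_cm k_int u]
      by (auto intro!: derivative_eq_intros simp: K_def)
    then have "(laplace has_real_derivative - (b + K u) * laplace u) (at u)"
      by (subst L) (use u in \<open>auto intro: has_field_derivative_transform_within_open[of _ _ _ "{0<..}"] simp: L\<close>)
    from DERIV_unique[OF this laplace_has_derivative[OF u]] show ?thesis
      by (simp only: mult_minus_left neg_equal_iff_equal)
  qed
  \<comment> \<open>The drift is still unknown here, so uniqueness of the transform first gives the
    equation with b in place of a.\<close>
  have g: "(x - b) * f x - C x = 0" if "x > a" for x
  proof (rule laplace_transform_eq_zero[OF a _ _ _ _ that])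
    show "continuous_on {a<..} (\<lambda>x. (x - b) * f x - C x)"
      unfolding C_def
      by (intro continuous_intros f_cont continuous_at_imp_continuous_on ballI density_kernel_convolution) auto
    show "(x - b) * f x - C x = 0" if "x < a" for x
      using that by (simp only: C_def convolution_eq_0 less_imp_le density_eq_0) simp
    fix u :: real assume u: "u > 0"
    have eq: "exp (- u * x) * ((x - b) * f x - C x)
        = x * exp (- u * x) * f x - b * (exp (- u * x) * f x) - exp (- u * x) * C x" for x
      by (simp add: algebra_simps)
    have i: "integrable lborel (\<lambda>x. x * exp (- u * x) * f x)"
      "integrable lborel (\<lambda>x. b * (exp (- u * x) * f x))" "integrable lborel (\<lambda>x. exp (- u * x) * C x)"
      using integrable_mult_exp_mult[OF f_meas f_nonneg density_eq_0_neg density_min_integrable u]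
        laplace_integrable[of u] u laplace_convolution[OF u]
      by (auto simp: C_def has_bochner_integral_iff)
    show "integrable lborel (\<lambda>x. exp (- u * x) * ((x - b) * f x - C x))"
      unfolding eq by (intro Bochner_Integration.integrable_diff i)
    have c: "(\<integral>x. exp (- u * x) * C x \<partial>lborel) = laplace u * K u"
      using laplace_convolution[OF u] by (simp only: C_def K_def has_bochner_integral_iff)
    have "(\<integral>x. exp (- u * x) * ((x - b) * f x - C x) \<partial>lborel) =
      (\<integral>x. x * exp (- u * x) * f x \<partial>lborel) - (\<integral>x. b * (exp (- u * x) * f x) \<partial>lborel)
        - (\<integral>x. exp (- u * x) * C x \<partial>lborel)"
      unfolding eq by (simp only: Bochner_Integration.integral_diff Bochner_Integration.integrable_diff i)
    also have "\<dots> = (\<integral>x. x * exp (- u * x) * f x \<partial>lborel) - b * laplace u - laplace u * K u"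
      unfolding c by (simp only: laplace_def integral_mult_right_zero)
    finally show "(\<integral>x. exp (- u * x) * ((x - b) * f x - C x) \<partial>lborel) = 0"
      using diff[OF u] by (simp add: algebra_simps)
  qed
  have "a \<le> b"
  proof -
    \<comment> \<open>Taking logarithms in L(u) \<le> exp(-ua) and dividing by u; the right-hand
      side tends to 0.\<close>
    have "eventually (\<lambda>u. a - b \<le> laplace_exponent k u / u) at_top"
      using eventually_gt_at_top[of 0]
    proof eventually_elim
      case (elim u)
      then have "exp (- (b * u + laplace_exponent k u)) \<le> exp (- u * a)"
        using laplace_le[of u] L[of u] by simp
      then have "a * u - b * u \<le> laplace_exponent k u" by (simp add: algebra_simps)
      then show ?case using elim by (simp add: pos_le_divide_eq left_diff_distrib)
    qed
    then have "a - b \<le> 0"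
      by (rule tendsto_lowerbound[OF laplace_exponent_over_tendsto[OF k_cm k_int]]) simp
    then show ?thesis by simp
  qed
  moreover have "b \<le> a"
  proof (rule ccontr)
    assume "\<not> b \<le> a"
    then obtain x where x: "a < x" "x < b" "f x > 0"
      using density_pos_somewhere[of a b] by force
    have "C x \<ge> 0" unfolding C_def
      using f_nonneg kernel_properties(2) by (intro Bochner_Integration.integral_nonneg) simp
    moreover have "(x - b) * f x < 0" using x by (simp add: mult_neg_pos)
    ultimately show False using g[OF x(1)] by simp
  qed
  ultimately show ?thesis using g[OF t] by (simp add: C_def)
qed

lemma convolution_equation_imp_laplace:
  assumes E: "\<And>t. t > a \<Longrightarrow> (t - a) * f t = (\<integral>s. f s * (indicator {0<..} (t - s) * k (t - s)) \<partial>lborel)"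
    and u: "u \<ge> 0"
  shows "laplace u = exp (- (a * u + laplace_exponent k u))"
proof -
  define C where "C t = (\<integral>s. f s * (indicator {0<..} (t - s) * k (t - s)) \<partial>lborel)" for t
  define K where "K u = (\<integral>t. exp (- u * t) * (indicator {0<..} t * k t) \<partial>lborel)" for u
  \<comment> \<open>Extends the equation to the whole line, so that it can be integrated against
    exp(-vx). At x = a it holds for any value of \<open>f a\<close>, the convolution being 0
    there.\<close>
  have C: "x * f x = a * f x + C x" for x
  proof (cases "x > a")
    case True
    then show ?thesis using E[OF True] by (simp add: C_def algebra_simps)
  next
    case False
    then have "C x = 0" by (simp only: C_def convolution_eq_0 not_less) simp
    then show ?thesis using False density_eq_0[of x] by (cases "x = a") auto
  qed
  have diff: "(\<integral>x. x * exp (- v * x) * f x \<partial>lborel) = (a + K v) * laplace v" if v: "v > 0" for v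
  proof -
    have "x * exp (- v * x) * f x = a * (exp (- v * x) * f x) + exp (- v * x) * C x" for x
      using arg_cong[OF C[of x], of "\<lambda>y. exp (- v * x) * y"] by (simp add: algebra_simps)
    then have "(\<integral>x. x * exp (- v * x) * f x \<partial>lborel) = (\<integral>x. a * (exp (- v * x) * f x) + exp (- v * x) * C x \<partial>lborel)"
      by simp
    also have "\<dots> = a * laplace v + laplace v * K v"
      using laplace_integrable[of v] v laplace_convolution[OF v]
      by (subst Bochner_Integration.integral_add) (auto simp: C_def K_def laplace_def has_bochner_integral_iff)
    finally show ?thesis by (simp add: algebra_simps)
  qed
  define \<Phi> where "\<Phi> v = laplace v * exp (a * v + laplace_exponent k v)" for v
  have "\<Phi> u = \<Phi> 0"
  proof (cases "u = 0")
    case False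
    \<comment> \<open>The derivative of \<Phi> is known only at positive points; continuity up to 0
      links \<open>\<Phi> u\<close> to \<open>\<Phi> 0\<close>.\<close>
    have "continuous_on {0..u} \<Phi>"
      unfolding \<Phi>_def
      by (intro continuous_intros continuous_on_subset[OF continuous_on_laplace]
          continuous_on_subset[OF continuous_on_laplace_exponent[OF k_cm k_int]]) auto
    moreover have "(\<Phi> has_real_derivative 0) (at v)" if v: "v > 0" for v
    proof -
      have "(laplace has_real_derivative - ((a + K v) * laplace v)) (at v)"
        using laplace_has_derivative[OF v] unfolding diff[OF v] .
      moreover have "((\<lambda>v. exp (a * v + laplace_exponent k v)) has_real_derivative
          exp (a * v + laplace_exponent k v) * (a + K v)) (at v)"
        using laplace_exponent_has_derivative[OF k_cm k_int v]
        by (auto intro!: derivative_eq_intros simp: K_def)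
      ultimately have "(\<Phi> has_real_derivative - ((a + K v) * laplace v) * exp (a * v + laplace_exponent k v)
          + exp (a * v + laplace_exponent k v) * (a + K v) * laplace v) (at v)"
        unfolding \<Phi>_def by (rule DERIV_mult)
      then show ?thesis by (simp add: mult_ac)
    qed
    ultimately show ?thesis using DERIV_isconst_end[of 0 u \<Phi>] u False by auto
  qed simp
  also have "\<Phi> 0 = 1" by (simp add: \<Phi>_def laplace_0 laplace_exponent_0)
  finally show ?thesis unfolding \<Phi>_def exp_minus by (simp add: field_simps)
qed

end

text \<open>The integrands can differ only at s = t, where the tail integral extends over all of (0,
  \<infinity>) and may diverge while the cut-off kernel is 0. Elsewhere f vanishes for s < a and the
  cut-off kernel for s > t.\<close>

lemma set_integral_tail_convolution:
  assumes t: "t \<ge> a" and k: "\<And>r. r > 0 \<Longrightarrow> (LINT x:{r<..}|lborel. m x) = k r"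
  shows "set_integrable lborel {a..t} (\<lambda>s. f s * (LINT x:{t - s<..}|lborel. m x)) \<longleftrightarrow>
      integrable lborel (\<lambda>s. f s * (indicator {0<..} (t - s) * k (t - s)))"
    and "(LINT s:{a..t}|lborel. f s * (LINT x:{t - s<..}|lborel. m x)) =
      (\<integral>s. f s * (indicator {0<..} (t - s) * k (t - s)) \<partial>lborel)"
proof -
  let ?A = "\<lambda>s. f s * (indicator {0<..} (t - s) * k (t - s))"
  let ?B = "\<lambda>s. indicator {a..t} s *\<^sub>R (f s * (LINT x:{t - s<..}|lborel. m x))"
  have AB: "?B s = ?A s" if "s \<noteq> t" for s
    using that k[of "t - s"] density_eq_0[of s] by (auto simp: indicator_def)
  show "set_integrable lborel {a..t} (\<lambda>s. f s * (LINT x:{t - s<..}|lborel. m x)) \<longleftrightarrow> integrable lborel ?A"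
    unfolding set_integrable_def
    by (rule integrable_discrete_difference[of "{t}"]) (use AB in auto)
  show "(LINT s:{a..t}|lborel. f s * (LINT x:{t - s<..}|lborel. m x)) = (\<integral>s. ?A s \<partial>lborel)"
    unfolding set_lebesgue_integral_def[of _ "{a..t}"]
    by (rule integral_discrete_difference[of "{t}"]) (use AB in auto)
qed

lemma kernel_set_integrable:
  assumes k: "completely_monotone k"
    and inf: "integrable lborel (\<lambda>t. indicator {1<..} t * (k t / t))"
    and conv: "\<And>t. t \<ge> a \<Longrightarrow> integrable lborel (\<lambda>s. f s * (indicator {0<..} (t - s) * k (t - s)))"
  shows "set_integrable lborel {0<..} (\<lambda>t. min 1 t * (k t / t))"
proof -
  obtain t where t: "t > a" "f t > 0" using density_pos_somewhere[of a "a + 1"] by force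
  then have "isCont f t" using f_cont by (simp add: continuous_on_eq_continuous_at)
  then have "eventually (\<lambda>s. f s > f t / 2) (at t)"
    using t by (intro order_tendstoD) (auto simp: isCont_def)
  then obtain d' where d': "d' > 0" "\<And>s. s \<noteq> t \<Longrightarrow> dist s t < d' \<Longrightarrow> f s > f t / 2"
    by (auto simp: eventually_at)
  define d where "d = min d' 1"
  have d: "d > 0" "d \<le> 1" "\<And>x. 0 < x \<Longrightarrow> x < d \<Longrightarrow> f (t - x) > f t / 2"
    using d' by (auto simp: d_def dist_real_def)
  have [measurable]: "(\<lambda>x. indicator {0<..} x * k x) \<in> borel_measurable borel"
    by (rule completely_monotone_measurable[OF k])
  \<comment> \<open>The convolution integral at t after the substitution s = t - x. Since f(t - x) >
    f(t)/2 for 0 < x < d, the factor 2/f(t) makes it a majorant of k on (0,d).\<close>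
  have I1: "integrable lborel (\<lambda>x. 2 / f t * (f (t - x) * (indicator {0<..} x * k x)))"
    using lborel_integrable_real_affine[OF conv, of t "-1" t] t by simp
  have I2: "integrable lborel (\<lambda>x. indicator {d..1} x * k d)"
    by (intro integrable_mult_left integrable_real_indicator) (auto simp: emeasure_lborel_Icc_eq)
  show ?thesis unfolding set_integrable_def
  proof (rule Bochner_Integration.integrable_bound)
    \<comment> \<open>The three summands dominate in turn on (0,d), on [d,1] by monotonicity of k,
      and beyond 1.\<close>
    show "integrable lborel (\<lambda>x. 2 / f t * (f (t - x) * (indicator {0<..} x * k x)) + indicator {d..1} x * k d + indicator {1<..} x * (k x / x))"
      by (intro Bochner_Integration.integrable_add I1 I2 inf)
    have "(\<lambda>x. min 1 x * ((indicator {0<..} x * k x) / x)) \<in> borel_measurable lborel" by measurable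
    then show "(\<lambda>x. indicator {0<..} x *\<^sub>R (min 1 x * (k x / x))) \<in> borel_measurable lborel"
      by (simp add: mult.left_commute)
    show "AE x in lborel. norm (indicator {0<..} x *\<^sub>R (min 1 x * (k x / x))) \<le>
      norm (2 / f t * (f (t - x) * (indicator {0<..} x * k x)) + indicator {d..1} x * k d + indicator {1<..} x * (k x / x))"
    proof (rule AE_I2)
      fix x
      show "norm (indicator {0<..} x *\<^sub>R (min 1 x * (k x / x))) \<le>
      norm (2 / f t * (f (t - x) * (indicator {0<..} x * k x)) + indicator {d..1} x * k d + indicator {1<..} x * (k x / x))"
        (is "_ \<le> norm (?p + ?q + ?r)")
      proof (cases "x > 0")
        case True
        have kx: "k x \<ge> 0" "k d \<ge> 0" using completely_monotone_nonneg[OF k] True d by auto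
        have nn: "?p \<ge> 0" "?q \<ge> 0" "?r \<ge> 0"
          using kx True t f_nonneg[of "t - x"] by (auto simp: indicator_def)
        have "min 1 x * (k x / x) \<le> ?p + ?q + ?r"
        proof -
          consider "x < d" | "d \<le> x" "x \<le> 1" | "x > 1" by linarith
          then show ?thesis
          proof cases
            case 1
            have "1 * k x \<le> (2 / f t * f (t - x)) * k x"
              using d(3)[OF True 1] t kx by (intro mult_right_mono) (auto simp: field_simps)
            then have "k x \<le> ?p" using True by (simp add: mult.assoc)
            then show ?thesis using nn 1 d True by simp
          next
            case 2
            then have "k x \<le> ?q" using completely_monotone_antimono[OF k d(1), of x] by simp
            then show ?thesis using nn 2 True by simp
          next
            case 3
            then show ?thesis using nn by simp
          qed
        qed
        then show ?thesis using True kx nn by simp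
      qed simp
    qed
  qed
qed

lemma generalized_gamma_convolution_iff:
  "generalized_gamma_convolution (density lborel (\<lambda>t. ennreal (f t))) \<longleftrightarrow>
    (\<exists>b k. b \<ge> 0 \<and> completely_monotone k \<and>
        set_integrable lborel {0<..} (\<lambda>t. min 1 t * (k t / t)) \<and>
        (\<forall>u\<ge>0. laplace u = exp (- (b * u + laplace_exponent k u))))"
proof -
  let ?M = "density lborel (\<lambda>t. ennreal (f t))"
  have "emeasure ?M (space ?M) = 1"
    using f_prob by (simp add: emeasure_density)
  then have p: "prob_space ?M" by (rule prob_spaceI)
  have "emeasure ?M {0..} = (\<integral>\<^sup>+x. ennreal (f x) \<partial>lborel)"
    by (subst emeasure_density) (auto intro!: nn_integral_cong simp: density_eq_0_neg indicator_def)
  then have "measure ?M {0..} = 1" using f_prob by (simp add: measure_def)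
  with p show ?thesis
    unfolding generalized_gamma_convolution_def integral_eq_laplace
    by (simp add: laplace_exponent_eq)
qed

end

theorem corollary3p6:
  fixes a :: real and f :: "real \<Rightarrow> real"
  assumes "a \<ge> 0"
    and "f \<in> borel_measurable borel"
    and "\<And>t. f t \<ge> 0"
    and "(\<integral>\<^sup>+ t. ennreal (f t) \<partial>lborel) = 1"
    and "closure {t. f t \<noteq> 0} = {a..}"
    and "continuous_on {a<..} f"
  shows "generalized_gamma_convolution (density lborel (\<lambda>t. ennreal (f t))) \<longleftrightarrow>
    (\<exists>m. completely_monotone m \<and>
         set_integrable lborel {0<..} (\<lambda>x. max 0 (ln x) * m x) \<and>
         satisfies_integral_equation a m f)"
proof
  assume "generalized_gamma_convolution (density lborel (\<lambda>t. ennreal (f t)))"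
  then obtain b k where k: "completely_monotone k"
    "set_integrable lborel {0<..} (\<lambda>t. min 1 t * (k t / t))"
    and L: "\<And>u. u \<ge> 0 \<Longrightarrow> laplace f u = exp (- (b * u + laplace_exponent k u))"
    unfolding generalized_gamma_convolution_iff[OF assms] by blast
  have eq: "(a - t) * f t + (\<integral>s. f s * (indicator {0<..} (t - s) * k (t - s)) \<partial>lborel) = 0" if "t \<ge> a" for t
  proof (cases "t = a")
    case True
    then have "(\<integral>s. f s * (indicator {0<..} (t - s) * k (t - s)) \<partial>lborel) = 0"
      by (simp only: convolution_eq_0[OF assms order.refl]) simp
    then show ?thesis using True by simp
  next
    case False
    then show ?thesis using laplace_imp_convolution_equation[OF assms k L, of t] that
      by (simp add: algebra_simps)
  qed
  have "satisfies_integral_equation a (\<lambda>x. - deriv k x) f"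
    unfolding satisfies_integral_equation_def
    using set_integral_tail_convolution[OF assms _ tail_integral_uminus_deriv(2)[OF k]] eq
      density_kernel_convolution_integrable[OF assms k] by simp
  then show "\<exists>m. completely_monotone m \<and> set_integrable lborel {0<..} (\<lambda>x. max 0 (ln x) * m x) \<and>
      satisfies_integral_equation a m f"
    using completely_monotone_uminus_deriv[OF k(1)] log_integrable_uminus_deriv[OF k] by blast
next
  assume "\<exists>m. completely_monotone m \<and> set_integrable lborel {0<..} (\<lambda>x. max 0 (ln x) * m x) \<and>
      satisfies_integral_equation a m f"
  then obtain m where m: "completely_monotone m" "set_integrable lborel {0<..} (\<lambda>x. max 0 (ln x) * m x)"
    and eq: "satisfies_integral_equation a m f" by blast
  define k where "k t = (LINT x:{t<..}|lborel. m x)" for t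
  have k: "completely_monotone k"
    unfolding k_def by (rule completely_monotone_tail_integral[OF m])
  \<comment> \<open>In this direction k is defined as the tail integral of m, so the link between m
    and k holds by definition.\<close>
  note iff = set_integral_tail_convolution[OF assms, of _ m k, OF _ k_def[symmetric]]
  have conv: "integrable lborel (\<lambda>s. f s * (indicator {0<..} (t - s) * k (t - s)))"
    "(a - t) * f t + (\<integral>s. f s * (indicator {0<..} (t - s) * k (t - s)) \<partial>lborel) = 0" if "t \<ge> a" for t
    using eq that iff[OF that] unfolding satisfies_integral_equation_def by auto
  have ki: "set_integrable lborel {0<..} (\<lambda>t. min 1 t * (k t / t))"
    by (rule kernel_set_integrable[OF assms k _ conv(1)])
       (use integrable_tail_integral_over[OF m] in \<open>simp add: k_def\<close>)
  \<comment> \<open>The drift of the resulting law is a, the left end of the support.\<close>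
  have "laplace f u = exp (- (a * u + laplace_exponent k u))" if "u \<ge> 0" for u
  proof (rule convolution_equation_imp_laplace[OF assms k ki _ that])
    fix t assume "t > a"
    then show "(t - a) * f t = (\<integral>s. f s * (indicator {0<..} (t - s) * k (t - s)) \<partial>lborel)"
      using conv(2)[of t] by (simp add: algebra_simps)
  qed
  then show "generalized_gamma_convolution (density lborel (\<lambda>t. ennreal (f t)))"
    unfolding generalized_gamma_convolution_iff[OF assms] using \<open>a \<ge> 0\<close> k ki by blast
qed

end
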